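(* Let $G$ be a finite non-cyclic group. Then $G$ is a minimal non-$ES$-partition group if and only if $G$ is a Schmidt group.
   Context: Let $X$ be a finite group and $S$ a proper subgroup of $X$. A strict $S$-partition of $X$ is a finite set $\{H_1,\dots,H_n\}$ of (distinct) proper subgroups of $X$ such that $X = \bigcup_{i=1}^n H_i$ and $H_i \cap H_j = S$ for all $i \neq j$. It is called an $ES$-partition if in addition $|H_i| = |H_j|$ for all $i, j$. A finite non-cyclic group $G$ is a minimal non-$ES$-partition group if $G$ has no $ES$-partition for any subgroup $S$ of $G$, but every proper non-cyclic subgroup $H$ of $G$ has an $ET$-partition for some subgroup $T \leq H$. A Schmidt group (minimal non-nilpotent group) is a finite group that is not nilpotent but all of whose proper subgroups are nilpotent. *)

theory Defs
  imports "HOL-Algebra.Algebra"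
begin

definition proper_subgroup :: "'a set \<Rightarrow> ('a, 'b) monoid_scheme \<Rightarrow> bool" where
  "proper_subgroup H G \<longleftrightarrow> subgroup H G \<and> H \<noteq> carrier G"

definition strict_partition :: "('a, 'b) monoid_scheme \<Rightarrow> 'a set \<Rightarrow> 'a set set \<Rightarrow> bool" where
  "strict_partition G S \<H> \<longleftrightarrow>
     proper_subgroup S G \<and> finite \<H> \<and> (\<forall>H\<in>\<H>. proper_subgroup H G) \<and>
     carrier G = \<Union>\<H> \<and> (\<forall>H\<in>\<H>. \<forall>K\<in>\<H>. H \<noteq> K \<longrightarrow> H \<inter> K = S)"

definition ES_partition :: "('a, 'b) monoid_scheme \<Rightarrow> 'a set \<Rightarrow> 'a set set \<Rightarrow> bool" where
  "ES_partition G S \<H> \<longleftrightarrow> strict_partition G S \<H> \<and> (\<forall>H\<in>\<H>. \<forall>K\<in>\<H>. card H = card K)"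

definition minimal_non_ES_partition_group :: "('a, 'b) monoid_scheme \<Rightarrow> bool" where
  "minimal_non_ES_partition_group G \<longleftrightarrow>
     group G \<and> finite (carrier G) \<and> \<not> cyclic_group G \<and>
     \<not> (\<exists>S \<H>. subgroup S G \<and> ES_partition G S \<H>) \<and>
     (\<forall>H. proper_subgroup H G \<and> \<not> cyclic_group (G\<lparr>carrier := H\<rparr>) \<longrightarrow>
        (\<exists>T \<H>. subgroup T (G\<lparr>carrier := H\<rparr>) \<and> ES_partition (G\<lparr>carrier := H\<rparr>) T \<H>))"

text \<open>The index is shifted by one against the usual \<open>\<gamma>\<^sub>1(G) = G\<close>.\<close>

primrec lower_central :: "('a, 'b) monoid_scheme \<Rightarrow> nat \<Rightarrow> 'a set" where
  "lower_central G 0 = carrier G"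
| "lower_central G (Suc n) = generate G
     (\<Union>h \<in> lower_central G n. \<Union>g \<in> carrier G. {h \<otimes>\<^bsub>G\<^esub> g \<otimes>\<^bsub>G\<^esub> inv\<^bsub>G\<^esub> h \<otimes>\<^bsub>G\<^esub> inv\<^bsub>G\<^esub> g})"

definition nilpotent_group :: "('a, 'b) monoid_scheme \<Rightarrow> bool" where
  "nilpotent_group G \<longleftrightarrow> group G \<and> (\<exists>n. lower_central G n = {\<one>\<^bsub>G\<^esub>})"

definition Schmidt_group :: "('a, 'b) monoid_scheme \<Rightarrow> bool" where
  "Schmidt_group G \<longleftrightarrow>
     group G \<and> finite (carrier G) \<and> \<not> nilpotent_group G \<and>
     (\<forall>H. proper_subgroup H G \<longrightarrow> nilpotent_group (G\<lparr>carrier := H\<rparr>))"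

end

(*
Let G be a Schmidt group with an ES-partition into n components of order h, all containing S.  G has a
normal maximal subgroup M (compare conjugacy classes of maximal subgroups), say of prime index q; the
Sylow r-subgroups for r different from q are characteristic in the nilpotent group M, hence normal in G.
So a Sylow q-subgroup is not normal, and minimality of G forces it to be cyclic.  Being cyclic it lies in
a component, so every component, having the same order, contains exactly one Sylow q-subgroup Q and lies
in its normalizer.  Distinct components contain distinct Sylow q-subgroups, so n <= |G : N(Q)| and
h <= |N(Q)|, which contradicts |G| = |S| + n (h - |S|).

Conversely a noncyclic nilpotent group has two maximal subgroups of the same prime index p, both normal;
for their intersection N the subgroups H >= N with |H : N| = p form an ES-partition.  A minimal
nonnilpotent subgroup of a minimal non-ES-partition group is a Schmidt group without an ES-partition, so
it is the whole group.
*)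

theory Submission
  imports Defs
begin

subsection \<open>Actions of groups of prime power order\<close>

text \<open>A partition covers elements rather than subgroups, so a subgroup is certain to lie in a
  single component only if it has a single generator. This is why a cyclic Sylow subgroup is looked
  for; its failure to be normal is what makes its conjugates numerous enough to bound the number of
  components.

  Nilpotency is defined through the lower central series, whereas most arguments about Schmidt
  groups speak of normal Sylow subgroups. The translation is needed in both directions: nilpotent
  components have normal Sylow subgroups, and a nonnilpotent group has a Sylow subgroup that is not
  normal. The second direction is the harder one; it rests on the fact that each chief factor is
  centralized by every normal \<open>p\<close>-subgroup.

  The final contradiction comes from \<open>S\<close> being nonempty: the sum n h of the orders of
  the components counts \<open>S\<close> n times, so it exceeds |G| by (n - 1) |S|, while conjugacy
  gives n h <= |G|.\<close>

lemma group_actionI: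
  fixes G (structure)
  assumes "group G"
    and closed: "\<And>g x. \<lbrakk>g \<in> carrier G; x \<in> E\<rbrakk> \<Longrightarrow> f g x \<in> E"
    and one: "\<And>x. x \<in> E \<Longrightarrow> f \<one> x = x"
    and mult: "\<And>g h x. \<lbrakk>g \<in> carrier G; h \<in> carrier G; x \<in> E\<rbrakk> \<Longrightarrow> f (g \<otimes> h) x = f g (f h x)"
  shows "group_action G E (\<lambda>g. restrict (f g) E)"
proof -
  interpret group G by fact
  have inv: "f g (f (inv g) x) = x" "f (inv g) (f g x) = x" if "g \<in> carrier G" "x \<in> E" for g x
    using that mult[of g "inv g" x] mult[of "inv g" g x] one by auto
  have bij: "bij_betw (restrict (f g) E) E E" if g: "g \<in> carrier G" for g
  proof (rule bij_betw_byWitness[where f' = "f (inv g)"])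
    show "\<forall>a\<in>E. f (inv g) (restrict (f g) E a) = a" "\<forall>a'\<in>E. restrict (f g) E (f (inv g) a') = a'"
      using inv[OF g] closed[of "inv g"] g by auto
    show "restrict (f g) E ` E \<subseteq> E" "f (inv g) ` E \<subseteq> E"
      using closed g by auto
  qed
  \<comment> \<open>Members of \<open>Bij E\<close> are extensional, so the maps have to be cut off
    outside \<open>E\<close>.\<close>
  have Bij: "restrict (f g) E \<in> Bij E" if "g \<in> carrier G" for g
    using bij[OF that] by (simp add: Bij_def)
  have "restrict (f (g \<otimes> h)) E = compose E (restrict (f g) E) (restrict (f h) E)"
    if "g \<in> carrier G" "h \<in> carrier G" for g h
    using that by (auto simp: compose_def mult closed intro!: restrict_ext)
  then have "(\<lambda>g. restrict (f g) E) \<in> hom G (BijGroup E)"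
    by (auto simp: hom_def BijGroup_def Bij)
  then show ?thesis
    unfolding group_action_def group_hom_def group_hom_axioms_def
    by (simp add: group_BijGroup is_group)
qed

text \<open>The moved points fall into orbits whose sizes are powers of \<open>p\<close> other than
  1. This is the congruence between the size of \<open>E\<close> and the number of fixed points, in
  a form that serves two purposes: a fixed point exists if \<open>p\<close> does not divide
  \<open>card E\<close>, and a known fixed point has company if \<open>p\<close> does.\<close>

lemma (in group_action) p_group_dvd_card_moved:
  assumes p: "Factorial_Ring.prime p" and ord: "order G = p ^ k" and E: "finite E"
  shows "p dvd card {x \<in> E. \<exists>g\<in>carrier G. \<phi> g x \<noteq> x}"
proof -
  let ?M = "{x \<in> E. \<exists>g\<in>carrier G. \<phi> g x \<noteq> x}"
  interpret group G using group_hom group_hom.axioms(1) by auto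
  let ?C = "{orbit G \<phi> x |x. x \<in> ?M}"
  have sub: "orbit G \<phi> x \<subseteq> ?M" if x: "x \<in> ?M" for x
  proof
    fix y assume y: "y \<in> orbit G \<phi> x"
    then have yE: "y \<in> E" using x element_image by (auto simp: orbit_def)
    have "\<exists>g\<in>carrier G. \<phi> g y \<noteq> y"
    proof (rule ccontr)
      assume "\<not> ?thesis"
      then have fixed: "\<phi> g y = y" if "g \<in> carrier G" for g using that by blast
      have "x \<in> orbit G \<phi> y" using orbit_sym x y yE by blast
      then have "x = y" using fixed by (auto simp: orbit_def)
      then show False using x fixed by auto
    qed
    then show "y \<in> ?M" using yE by blast
  qed
  have U: "\<Union> ?C = ?M"
    using sub orbit_refl by blast
  have dvd: "p dvd card (orbit G \<phi> x)" if x: "x \<in> ?M" for x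
  proof -
    have xE: "x \<in> E" using x by auto
    have "card (orbit G \<phi> x) dvd p ^ k"
      using orbit_stabilizer_theorem[OF xE] ord by (metis dvd_triv_left)
    then obtain i where i: "card (orbit G \<phi> x) = p ^ i"
      using p divides_primepow_nat by blast
    have "i \<noteq> 0"
    proof
      assume "i = 0"
      then have "card (orbit G \<phi> x) = 1" using i by simp
      then obtain a where a: "orbit G \<phi> x = {a}" by (auto simp: card_1_singleton_iff)
      then have "a = x" using orbit_refl[OF xE] by auto
      then have "\<phi> g x = x" if "g \<in> carrier G" for g
        using a that by (auto simp: orbit_def)
      then show False using x by auto
    qed
    then show ?thesis using i by (simp add: dvd_power)
  qed
  have "p dvd card (\<Union> ?C)"
  proof (rule dvd_partition)
    show "finite (\<Union> ?C)" using U E by simp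
    show "\<forall>c\<in>?C. p dvd card c" using dvd by blast
    show "\<forall>c1\<in>?C. \<forall>c2\<in>?C. c1 \<noteq> c2 \<longrightarrow> c1 \<inter> c2 = {}"
      using disjoint_union by (auto simp: orbits_def)
  qed
  then show ?thesis using U by simp
qed

context group
begin

section \<open>Orders of subgroups, conjugation and normalizers\<close>

lemma subgroup_restrict_iff:
  assumes "subgroup K G"
  shows "subgroup H (G\<lparr>carrier := K\<rparr>) \<longleftrightarrow> subgroup H G \<and> H \<subseteq> K"
proof
  assume H: "subgroup H (G\<lparr>carrier := K\<rparr>)"
  show "subgroup H G \<and> H \<subseteq> K"
    using incl_subgroup[OF assms H] subgroup.subset[OF H] by simp
qed (use assms subgroup_incl in blast)

lemma card_subgroup_dvd:
  assumes "subgroup H G" "subgroup K G" "H \<subseteq> K"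
  shows "card H dvd card K"
proof -
  interpret K: group "G\<lparr>carrier := K\<rparr>" by (rule subgroup_imp_group) fact
  have "subgroup H (G\<lparr>carrier := K\<rparr>)" using assms subgroup_restrict_iff by blast
  from K.lagrange[OF this, symmetric] show ?thesis by (simp add: order_def)
qed

lemma card_subgroup_dvd_order: "subgroup H G \<Longrightarrow> card H dvd order G"
  using lagrange by (metis dvd_triv_right)

lemma card_subgroup_pos: "finite (carrier G) \<Longrightarrow> subgroup H G \<Longrightarrow> 0 < card H"
  by (metis card_gt_0_iff empty_iff finite_subset subgroup.one_closed subgroup.subset)

lemma conj_coset_eq_image:
  assumes "H \<subseteq> carrier G" "g \<in> carrier G"
  shows "g <# H #> inv g = (\<lambda>h. g \<otimes> h \<otimes> inv g) ` H"
  by (auto simp: l_coset_def r_coset_def)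

lemma normalizer_iff:
  assumes "H \<subseteq> carrier G"
  shows "g \<in> normalizer G H \<longleftrightarrow> g \<in> carrier G \<and> (\<lambda>h. g \<otimes> h \<otimes> inv g) ` H = H"
  using assms by (auto simp: normalizer_def stabilizer_def conj_coset_eq_image)

lemma card_conj_set:
  assumes "H \<subseteq> carrier G" "g \<in> carrier G"
  shows "card ((\<lambda>h. g \<otimes> h \<otimes> inv g) ` H) = card H"
proof (intro card_image inj_onI)
  fix x y assume xy: "x \<in> H" "y \<in> H" "g \<otimes> x \<otimes> inv g = g \<otimes> y \<otimes> inv g"
  then have "x \<in> carrier G" "y \<in> carrier G" using assms by auto
  then show "x = y" using xy assms by simp
qed

text \<open>Conjugation is injective, so for a finite set one inclusion gives equality.\<close>

lemma normalizerI:
  assumes "H \<subseteq> carrier G" "finite H" "g \<in> carrier G" "\<And>h. h \<in> H \<Longrightarrow> g \<otimes> h \<otimes> inv g \<in> H"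
  shows "g \<in> normalizer G H"
proof -
  have "(\<lambda>h. g \<otimes> h \<otimes> inv g) ` H = H"
    using assms by (intro card_subset_eq) (auto simp: card_conj_set)
  then show ?thesis using normalizer_iff assms by auto
qed

lemma normalizerD: "\<lbrakk>H \<subseteq> carrier G; g \<in> normalizer G H; h \<in> H\<rbrakk> \<Longrightarrow> g \<otimes> h \<otimes> inv g \<in> H"
  using normalizer_iff by blast

lemma normalizer_subset_carrier: "H \<subseteq> carrier G \<Longrightarrow> normalizer G H \<subseteq> carrier G"
  using normalizer_iff by blast

lemma subgroup_subset_normalizer:
  assumes "subgroup H G" shows "H \<subseteq> normalizer G H"
proof -
  have "subgroup H (G\<lparr>carrier := normalizer G H\<rparr>)"
    using subgroup_in_normalizer[OF assms] normal_imp_subgroup by blast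
  then show ?thesis using subgroup.subset by fastforce
qed

lemma normal_iff_normalizer:
  assumes "subgroup H G"
  shows "H \<lhd> G \<longleftrightarrow> normalizer G H = carrier G"
proof -
  have sub: "H \<subseteq> carrier G" using assms by (rule subgroup.subset)
  show ?thesis
  proof
  assume n: "H \<lhd> G"
  show "normalizer G H = carrier G"
  proof
    show "normalizer G H \<subseteq> carrier G" using normalizer_subset_carrier[OF sub] .
    show "carrier G \<subseteq> normalizer G H"
    proof
      fix g assume g: "g \<in> carrier G"
      have cl: "g \<otimes> h \<otimes> inv g \<in> H" if "g \<in> carrier G" "h \<in> H" for g h
        using n normal.inv_op_closed2 that by metis
      have "h \<in> (\<lambda>h. g \<otimes> h \<otimes> inv g) ` H" if h: "h \<in> H" for h
      proof (rule image_eqI)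
        have "h \<in> carrier G" using h sub by blast
        then show "h = g \<otimes> (inv g \<otimes> h \<otimes> inv (inv g)) \<otimes> inv g"
          using g by (simp add: m_assoc) (simp flip: m_assoc)
        show "inv g \<otimes> h \<otimes> inv (inv g) \<in> H" using cl g h by blast
      qed
      then have "(\<lambda>h. g \<otimes> h \<otimes> inv g) ` H = H" using cl g by blast
      then show "g \<in> normalizer G H" using normalizer_iff[OF sub] g by blast
    qed
  qed
next
  assume e: "normalizer G H = carrier G"
  show "H \<lhd> G"
    using assms normalizerD[OF subgroup.subset[OF assms]] e by (intro normal_invI) auto
  qed
qed

subsection \<open>Sylow subgroups\<close>

text \<open>For a Sylow subgroup \<open>Q\<close> the hypothesis on the index holds, so this contains both the conjugacy of
  Sylow subgroups and the fact that \<open>p\<close>-subgroups lie in Sylow subgroups.\<close>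

lemma p_subgroup_subconjugate:
  assumes fin: "finite (carrier G)" and p: "Factorial_Ring.prime p"
    and P: "subgroup P G" "card P = p ^ k"
    and Q: "subgroup Q G" "\<not> p dvd card (rcosets Q)"
  shows "\<exists>g\<in>carrier G. \<forall>x\<in>P. g \<otimes> x \<otimes> inv g \<in> Q"
proof -
  interpret P: group "G\<lparr>carrier := P\<rparr>" by (rule subgroup_imp_group) fact
  have Psub: "P \<subseteq> carrier G" and Qsub: "Q \<subseteq> carrier G" using P Q subgroup.subset by auto
  have Csub: "C \<subseteq> carrier G" if "C \<in> rcosets Q" for C
    using that rcosets_subset_PowG[OF Q(1)] by blast
  \<comment> \<open>Right multiplication by the inverse turns the natural right action on the cosets
    \<open>Q #> a\<close> into a left action.\<close>
  have act: "group_action (G\<lparr>carrier := P\<rparr>) (rcosets Q) (\<lambda>g. restrict (\<lambda>C. C #> inv g) (rcosets Q))"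
  proof (rule group_actionI[OF P.is_group])
    fix g C assume g: "g \<in> carrier (G\<lparr>carrier := P\<rparr>)" and C: "C \<in> rcosets Q"
    then obtain a where a: "a \<in> carrier G" "C = Q #> a" by (auto simp: RCOSETS_def)
    have gG: "g \<in> carrier G" using g Psub by auto
    then have "C #> inv g = Q #> (a \<otimes> inv g)" using a Qsub by (simp add: coset_mult_assoc)
    then show "C #> inv g \<in> rcosets Q" using a gG Qsub by (simp add: rcosetsI)
  next
    fix C assume C: "C \<in> rcosets Q"
    then show "C #> inv \<one>\<^bsub>G\<lparr>carrier := P\<rparr>\<^esub> = C" using Csub by simp
  next
    fix g h C assume g: "g \<in> carrier (G\<lparr>carrier := P\<rparr>)" "h \<in> carrier (G\<lparr>carrier := P\<rparr>)" and C: "C \<in> rcosets Q"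
    then have "g \<in> carrier G" "h \<in> carrier G" using Psub by auto
    then show "C #> inv (g \<otimes>\<^bsub>G\<lparr>carrier := P\<rparr>\<^esub> h) = C #> inv h #> inv g"
      using Csub[OF C] by (simp add: inv_mult_group coset_mult_assoc)
  qed
  have finE: "finite (rcosets Q)"
    using rcosets_subset_PowG[OF Q(1)] fin finite_subset by auto
  let ?M = "{C \<in> rcosets Q. \<exists>g\<in>carrier (G\<lparr>carrier := P\<rparr>). restrict (\<lambda>C. C #> inv g) (rcosets Q) C \<noteq> C}"
  have "p dvd card ?M"
    using group_action.p_group_dvd_card_moved[OF act p _ finE] P(2) by (simp add: order_def)
  \<comment> \<open>The index is prime to \<open>p\<close>, so some coset \<open>Q #> a\<close> is
    fixed by all of \<open>P\<close>; being fixed by \<open>x\<close> means exactly that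
    \<open>a \<otimes> x \<otimes> inv a\<close> lies in \<open>Q\<close>.\<close>
  then have "?M \<noteq> rcosets Q" using Q(2) by metis
  then obtain C where "C \<in> rcosets Q" "C \<notin> ?M" by blast
  then have C: "C \<in> rcosets Q" "\<And>g. g \<in> P \<Longrightarrow> C #> inv g = C" by auto
  then obtain a where a: "a \<in> carrier G" "C = Q #> a" by (auto simp: RCOSETS_def)
  have "a \<otimes> x \<otimes> inv a \<in> Q" if x: "x \<in> P" for x
  proof -
    have xG: "x \<in> carrier G" using x Psub by auto
    have "C #> x = C"
      using C(2)[of "inv x"] x P(1) xG by (simp add: subgroup.m_inv_closed)
    then have "Q #> (a \<otimes> x) = Q #> a" using a xG Qsub by (simp add: coset_mult_assoc)
    then have "a \<otimes> x \<in> Q #> a" using rcos_self[of "a \<otimes> x" Q] a xG Q(1) by auto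
    then obtain q where q: "q \<in> Q" "a \<otimes> x = q \<otimes> a" by (auto simp: r_coset_def)
    have "q \<in> carrier G" using q Qsub by auto
    then have "a \<otimes> x \<otimes> inv a = q" using q a by (simp add: m_assoc)
    then show ?thesis using q by simp
  qed
  then show ?thesis using a by blast
qed

text \<open>The exponent may be 0: for a prime not dividing the order the trivial subgroup is the
  Sylow subgroup. Statements can therefore range over all primes.\<close>

definition sylow_subgroup :: "nat \<Rightarrow> 'a set \<Rightarrow> bool" where
  "sylow_subgroup p P \<longleftrightarrow> subgroup P G \<and> card P = p ^ multiplicity p (order G)"

lemma sylow_subgroup_exists:
  assumes "finite (carrier G)" "Factorial_Ring.prime p"
  shows "\<exists>P. sylow_subgroup p P"
proof -
  have "order G > 0" using assms order_gt_0_iff_finite by blast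
  then obtain m where "order G = p ^ multiplicity p (order G) * m"
    using multiplicity_dvd by (metis dvdE)
  then have "sylow G p (multiplicity p (order G)) m"
    unfolding sylow_eq sylow_axioms_def using assms is_group by blast
  from sylow.sylow_thm[OF this] show ?thesis by (auto simp: sylow_subgroup_def)
qed

lemma sylow_subgroup_index:
  assumes "finite (carrier G)" "Factorial_Ring.prime p" "sylow_subgroup p P"
  shows "\<not> p dvd card (rcosets P)"
proof
  assume "p dvd card (rcosets P)"
  then obtain c where c: "card (rcosets P) = p * c" by blast
  have "order G = card (rcosets P) * card P" using assms lagrange by (metis sylow_subgroup_def)
  then have "p ^ Suc (multiplicity p (order G)) dvd order G"
    using c assms(3) by (simp add: sylow_subgroup_def)
  moreover have "order G > 0" using assms order_gt_0_iff_finite by blast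
  ultimately show False
    using assms(2) by (metis Suc_n_not_le_n multiplicity_geI not_prime_unit gr_implies_not0)
qed

lemma sylow_subgroup_subset: "sylow_subgroup p P \<Longrightarrow> P \<subseteq> carrier G"
  by (auto simp: sylow_subgroup_def subgroup.subset)

lemma sylow_subgroup_finite: "finite (carrier G) \<Longrightarrow> sylow_subgroup p P \<Longrightarrow> finite P"
  using sylow_subgroup_subset finite_subset by blast

lemma sylow_subgroup_conjugate:
  assumes "finite (carrier G)" "Factorial_Ring.prime p" "sylow_subgroup p P" "sylow_subgroup p Q"
  shows "\<exists>g\<in>carrier G. (\<lambda>x. g \<otimes> x \<otimes> inv g) ` P = Q"
proof -
  obtain g where g: "g \<in> carrier G" "\<forall>x\<in>P. g \<otimes> x \<otimes> inv g \<in> Q"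
    using p_subgroup_subconjugate[OF assms(1,2) _ _ _ sylow_subgroup_index[OF assms(1,2,4)]] assms(3,4)
    unfolding sylow_subgroup_def by blast
  have "(\<lambda>x. g \<otimes> x \<otimes> inv g) ` P = Q"
  proof (rule card_subset_eq)
    show "finite Q" using assms sylow_subgroup_finite by blast
    show "card ((\<lambda>x. g \<otimes> x \<otimes> inv g) ` P) = card Q"
      using card_conj_set g sylow_subgroup_subset assms by (simp add: sylow_subgroup_def)
  qed (use g in auto)
  then show ?thesis using g by blast
qed

lemma normal_sylow_subgroup_unique:
  assumes "finite (carrier G)" "Factorial_Ring.prime p" "sylow_subgroup p P" "sylow_subgroup p Q" "P \<lhd> G"
  shows "P = Q"
proof -
  obtain g where g: "g \<in> carrier G" "(\<lambda>x. g \<otimes> x \<otimes> inv g) ` P = Q"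
    using sylow_subgroup_conjugate assms by meson
  have "g \<in> normalizer G P"
    using g(1) normal_iff_normalizer[OF normal_imp_subgroup] assms(5) by simp
  then show ?thesis using g(2) normalizer_iff[OF sylow_subgroup_subset[OF assms(3)]] by simp
qed

lemma sylow_subgroup_restrict:
  assumes fin: "finite (carrier G)" and p: "Factorial_Ring.prime p"
    and P: "sylow_subgroup p P" and K: "subgroup K G" "P \<subseteq> K"
  shows "group.sylow_subgroup (G\<lparr>carrier := K\<rparr>) p P"
proof -
  interpret K: group "G\<lparr>carrier := K\<rparr>" by (rule subgroup_imp_group) fact
  have sP: "subgroup P G" and cP: "card P = p ^ multiplicity p (order G)"
    using P by (auto simp: sylow_subgroup_def)
  have pos: "card K > 0" "order G > 0"
    using card_subgroup_pos fin K order_gt_0_iff_finite by blast+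
  have "p ^ multiplicity p (order G) dvd card K"
    using card_subgroup_dvd[OF sP K] cP by simp
  then have "multiplicity p (order G) \<le> multiplicity p (card K)"
    using pos p by (metis multiplicity_geI not_prime_unit neq0_conv)
  moreover have "multiplicity p (card K) \<le> multiplicity p (order G)"
    using card_subgroup_dvd_order[OF K(1)] pos by (simp add: dvd_imp_multiplicity_le)
  ultimately show ?thesis
    using sP cP K subgroup_incl by (simp add: K.sylow_subgroup_def order_def)
qed

text \<open>Facts about Sylow subgroups of a nilpotent subgroup \<open>K\<close> are carried to the
  whole group this way. The hypothesis on multiplicities is met when \<open>p\<close> does not
  divide the index of \<open>K\<close>.\<close>

lemma sylow_subgroup_of_subgroup:
  assumes fin: "finite (carrier G)" and K: "subgroup K G"
    and P: "group.sylow_subgroup (G\<lparr>carrier := K\<rparr>) p P"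
    and m: "multiplicity p (card K) = multiplicity p (order G)"
  shows "sylow_subgroup p P"
proof -
  interpret K: group "G\<lparr>carrier := K\<rparr>" by (rule subgroup_imp_group) fact
  show ?thesis
    using P m incl_subgroup[OF K] by (simp add: K.sylow_subgroup_def sylow_subgroup_def order_def)
qed

lemma subgroup_conj:
  assumes H: "subgroup H G" and g: "g \<in> carrier G"
  shows "subgroup ((\<lambda>h. g \<otimes> h \<otimes> inv g) ` H) G"
proof -
  have sub: "H \<subseteq> carrier G" using H by (rule subgroup.subset)
  show ?thesis
  proof (rule subgroupI)
    show "(\<lambda>h. g \<otimes> h \<otimes> inv g) ` H \<subseteq> carrier G" using sub g by auto
    show "(\<lambda>h. g \<otimes> h \<otimes> inv g) ` H \<noteq> {}" using subgroup.one_closed[OF H] by auto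
  next
    fix a assume "a \<in> (\<lambda>h. g \<otimes> h \<otimes> inv g) ` H"
    then obtain h where h: "h \<in> H" "a = g \<otimes> h \<otimes> inv g" by auto
    moreover have "h \<in> carrier G" using h sub by auto
    ultimately have "inv a = g \<otimes> inv h \<otimes> inv g" using g by (simp add: inv_mult_group m_assoc)
    then show "inv a \<in> (\<lambda>h. g \<otimes> h \<otimes> inv g) ` H" using h subgroup.m_inv_closed[OF H] by blast
  next
    fix a b assume "a \<in> (\<lambda>h. g \<otimes> h \<otimes> inv g) ` H" "b \<in> (\<lambda>h. g \<otimes> h \<otimes> inv g) ` H"
    then obtain h k where h: "h \<in> H" "a = g \<otimes> h \<otimes> inv g" "k \<in> H" "b = g \<otimes> k \<otimes> inv g" by auto
    have hk: "h \<in> carrier G" "k \<in> carrier G" using h sub by auto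
    have "inv g \<otimes> (g \<otimes> (k \<otimes> inv g)) = k \<otimes> inv g" using hk g by (simp flip: m_assoc)
    then have "a \<otimes> b = g \<otimes> (h \<otimes> k) \<otimes> inv g" using h hk g by (simp add: m_assoc)
    then show "a \<otimes> b \<in> (\<lambda>h. g \<otimes> h \<otimes> inv g) ` H"
      using h subgroup.m_closed[OF H] by blast
  qed
qed

subsection \<open>Nilpotent groups\<close>

lemma lower_central_subset: "lower_central G n \<subseteq> carrier G"
proof (induction n)
  case (Suc n)
  then show ?case
    by (auto intro!: generate_incl dest: subsetD)
qed simp

lemma commutator_in_lower_central:
  "\<lbrakk>h \<in> lower_central G n; g \<in> carrier G\<rbrakk> \<Longrightarrow> h \<otimes> g \<otimes> inv h \<otimes> inv g \<in> lower_central G (Suc n)"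
  by (auto intro!: generate.incl)

text \<open>A conjugate of a commutator is the commutator of the conjugates, so the generating set
  of each term is invariant under conjugation.\<close>

lemma lower_central_normal: "lower_central G n \<lhd> G"
proof (induction n)
  case 0
  then show ?case by (simp add: normal_self)
next
  case (Suc n)
  show ?case unfolding lower_central.simps
  proof (rule normal_generateI)
    show "(\<Union>h\<in>lower_central G n. \<Union>g\<in>carrier G. {h \<otimes> g \<otimes> inv h \<otimes> inv g}) \<subseteq> carrier G"
      using subsetD[OF lower_central_subset] by auto
  next
    fix c k
    assume "c \<in> (\<Union>h\<in>lower_central G n. \<Union>g\<in>carrier G. {h \<otimes> g \<otimes> inv h \<otimes> inv g})" and k: "k \<in> carrier G"
    then obtain h g where hg: "h \<in> lower_central G n" "g \<in> carrier G" "c = h \<otimes> g \<otimes> inv h \<otimes> inv g"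
      by auto
    have h: "h \<in> carrier G" using hg lower_central_subset by blast
    have canc: "inv k \<otimes> (k \<otimes> x) = x" if "x \<in> carrier G" for x
      using that k by (simp flip: m_assoc)
    have "k \<otimes> c \<otimes> inv k = (k \<otimes> h \<otimes> inv k) \<otimes> (k \<otimes> g \<otimes> inv k) \<otimes> inv (k \<otimes> h \<otimes> inv k) \<otimes> inv (k \<otimes> g \<otimes> inv k)"
      using h hg k by (simp add: m_assoc inv_mult_group canc)
    moreover have "k \<otimes> h \<otimes> inv k \<in> lower_central G n"
      using Suc hg k normal.inv_op_closed2 by metis
    ultimately show "k \<otimes> c \<otimes> inv k \<in> (\<Union>h\<in>lower_central G n. \<Union>g\<in>carrier G. {h \<otimes> g \<otimes> inv h \<otimes> inv g})"
      using k hg by blast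
  qed
qed

text \<open>Consider the term of the lower central series just before the first one contained in
  \<open>H\<close>. Its commutators with group elements lie in the next term, hence in
  \<open>H\<close>, so all of it normalizes \<open>H\<close>.\<close>

lemma nilpotent_normalizer_grows:
  assumes nil: "nilpotent_group G" and fin: "finite (carrier G)"
    and H: "subgroup H G" "H \<noteq> carrier G"
  shows "\<exists>x\<in>normalizer G H. x \<notin> H"
proof -
  obtain n where n: "lower_central G n = {\<one>}" using nil by (auto simp: nilpotent_group_def)
  have sub: "H \<subseteq> carrier G" using H by (simp add: subgroup.subset)
  have ex: "lower_central G n \<subseteq> H" using n subgroup.one_closed[OF H(1)] by simp
  let ?m = "LEAST n. lower_central G n \<subseteq> H"
  have m: "lower_central G ?m \<subseteq> H" using ex by (rule LeastI)
  have "?m \<noteq> 0"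
    using m sub H(2) by (metis lower_central.simps(1) subset_antisym)
  then obtain k where k: "?m = Suc k" using not0_implies_Suc by blast
  then have "\<not> lower_central G k \<subseteq> H" by (metis lessI not_less_Least)
  then obtain x where x: "x \<in> lower_central G k" "x \<notin> H" by blast
  have xG: "x \<in> carrier G" using x lower_central_subset by blast
  have "x \<otimes> h \<otimes> inv x \<in> H" if h: "h \<in> H" for h
  proof -
    have hG: "h \<in> carrier G" using h sub by blast
    have "x \<otimes> h \<otimes> inv x \<otimes> inv h \<in> H"
      using commutator_in_lower_central[OF x(1) hG] m k by auto
    then have "x \<otimes> h \<otimes> inv x \<otimes> inv h \<otimes> h \<in> H" using h subgroup.m_closed[OF H(1)] by blast
    then show ?thesis using xG hG by (simp add: m_assoc)
  qed
  then have "x \<in> normalizer G H"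
    using normalizerI[OF sub _ xG] fin finite_subset sub by blast
  then show ?thesis using x by blast
qed

text \<open>A Frattini argument: the normalizer of a Sylow subgroup is self-normalizing.\<close>

lemma nilpotent_sylow_normal:
  assumes nil: "nilpotent_group G" and fin: "finite (carrier G)" and p: "Factorial_Ring.prime p"
    and P: "sylow_subgroup p P"
  shows "P \<lhd> G"
proof -
  let ?N = "normalizer G P"
  have sP: "subgroup P G" using P by (simp add: sylow_subgroup_def)
  have subP: "P \<subseteq> carrier G" using P by (rule sylow_subgroup_subset)
  have sN: "subgroup ?N G" using subP by (rule normalizer_imp_subgroup)
  have subN: "?N \<subseteq> carrier G" using sN by (rule subgroup.subset)
  interpret N: group "G\<lparr>carrier := ?N\<rparr>" using sN by (rule subgroup_imp_group)
  have finN: "finite (carrier (G\<lparr>carrier := ?N\<rparr>))" using fin finite_subset[OF subN] by simp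
  have "?N = carrier G"
  proof (rule ccontr)
    assume "?N \<noteq> carrier G"
    then obtain x where x: "x \<in> normalizer G ?N" "x \<notin> ?N"
      using nilpotent_normalizer_grows[OF nil fin sN] by blast
    have xG: "x \<in> carrier G" using x normalizer_iff[OF subN] by blast
    let ?P = "(\<lambda>h. x \<otimes> h \<otimes> inv x) ` P"
    have PN: "P \<subseteq> ?N" using subgroup_subset_normalizer[OF sP] .
    then have P'N: "?P \<subseteq> ?N" using normalizerD[OF subN x(1)] by blast
    have "sylow_subgroup p ?P"
      using P subgroup_conj[OF sP xG] card_conj_set[OF subP xG] by (simp add: sylow_subgroup_def)
    then have "N.sylow_subgroup p ?P" "N.sylow_subgroup p P"
      using sylow_subgroup_restrict[OF fin p _ sN] P PN P'N by blast+
    moreover have "P \<lhd> G\<lparr>carrier := ?N\<rparr>" using subgroup_in_normalizer[OF sP] .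
    ultimately have "P = ?P" using N.normal_sylow_subgroup_unique[OF finN p] by blast
    then show False using x(2) normalizer_iff[OF subP] xG by simp
  qed
  then show ?thesis using normal_iff_normalizer[OF sP] by simp
qed

section \<open>Coprime orders and the passage from Sylow subgroups to the whole group\<close>

text \<open>Bezout's identity makes \<open>x\<close> a product of powers of \<open>x [^] m\<close>
  and \<open>x [^] n\<close>. With \<open>H\<close> trivial this separates subgroups of coprime
  order; with \<open>H\<close> normal it is an argument in the factor group.\<close>

lemma coprime_pow_mem:
  fixes m n :: nat
  assumes H: "subgroup H G" and x: "x \<in> carrier G" and "x [^] m \<in> H" "x [^] n \<in> H" and c: "coprime m n"
  shows "x \<in> H"
proof -
  obtain u v :: int where uv: "u * int m + v * int n = 1"
    using bezout_int[of "int m" "int n"] c by auto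
  have "x [^] (int m * u) \<in> H" "x [^] (int n * v) \<in> H"
    using subgroup_int_pow_closed[OF H] assms(3,4) x by (simp_all flip: int_pow_pow add: int_pow_int)
  then have "x [^] (int m * u) \<otimes> x [^] (int n * v) \<in> H" using subgroup.m_closed[OF H] by blast
  then have "x [^] (int m * u + int n * v) \<in> H" using x by (simp add: int_pow_mult)
  moreover have "int m * u + int n * v = 1" using uv by (simp add: mult.commute)
  ultimately show ?thesis using x by simp
qed

lemma pow_card_subgroup:
  assumes "finite (carrier G)" "subgroup H G" "x \<in> H"
  shows "x [^] card H = \<one>"
proof -
  interpret H: group "G\<lparr>carrier := H\<rparr>" by (rule subgroup_imp_group) fact
  show ?thesis using H.pow_order_eq_1[of x] assms(3) by (simp add: order_def flip: nat_pow_consistent)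
qed

lemma card_distinct_sylow_coprime:
  assumes "Factorial_Ring.prime p" "Factorial_Ring.prime q" "p \<noteq> q" "sylow_subgroup p P" "sylow_subgroup q Q"
  shows "coprime (card P) (card Q)"
  using assms primes_coprime[of p q] by (simp add: sylow_subgroup_def)

lemma normal_sylow_subgroups_commute:
  assumes "finite (carrier G)" "Factorial_Ring.prime p" "Factorial_Ring.prime q" "p \<noteq> q" "sylow_subgroup p P" "sylow_subgroup q Q"
    and "P \<lhd> G" "Q \<lhd> G" "x \<in> P" "y \<in> Q"
  shows "x \<otimes> y = y \<otimes> x"
proof (rule normal_imp_commuting)
  show "P \<inter> Q \<subseteq> {\<one>}"
  proof
    fix z assume z: "z \<in> P \<inter> Q"
    have "z \<in> carrier G" using z assms(5) sylow_subgroup_subset by blast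
    moreover have "z [^] card P = \<one>" "z [^] card Q = \<one>"
      using z pow_card_subgroup[OF assms(1)] assms(5,6) unfolding sylow_subgroup_def by blast+
    ultimately show "z \<in> {\<one>}"
      using coprime_pow_mem[OF triv_subgroup] card_distinct_sylow_coprime[OF assms(2-6)] by simp
  qed
qed (use assms in auto)

text \<open>The order of \<open>C\<close> is divisible by the full power of each prime in
  \<open>order G\<close>. Applied to centralizers and normalizers, this reduces a question about all
  elements to one Sylow subgroup for each prime.\<close>

lemma eq_carrier_if_contains_sylow:
  assumes fin: "finite (carrier G)" and C: "subgroup C G"
    and "\<And>p. Factorial_Ring.prime p \<Longrightarrow> \<exists>P. sylow_subgroup p P \<and> P \<subseteq> C"
  shows "C = carrier G"
proof -
  have pos: "card C > 0" "order G > 0"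
    using card_subgroup_pos fin C order_gt_0_iff_finite by blast+
  have "order G dvd card C"
  proof (rule multiplicity_le_imp_dvd)
    fix p :: nat assume p: "Factorial_Ring.prime p"
    then obtain P where P: "sylow_subgroup p P" "P \<subseteq> C" using assms by blast
    then have "p ^ multiplicity p (order G) dvd card C"
      using card_subgroup_dvd[OF _ C, of P] by (auto simp: sylow_subgroup_def)
    then show "multiplicity p (order G) \<le> multiplicity p (card C)"
      using pos p by (metis multiplicity_geI not_prime_unit neq0_conv)
  qed (use pos in simp)
  then have "order G \<le> card C" using pos by (simp add: dvd_imp_le)
  then show ?thesis
    using fin subgroup.subset[OF C] card_seteq by (metis order_def)
qed

lemma pow_card_rcosets_mem:
  assumes "finite (carrier G)" and R: "subgroup R G" and T: "T \<lhd> G" "T \<subseteq> R" and x: "x \<in> R"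
  shows "x [^] card ((\<lambda>x. T #> x) ` R) \<in> T"
proof -
  interpret R: group "G\<lparr>carrier := R\<rparr>" by (rule subgroup_imp_group) fact
  have sT: "subgroup T G" using T normal_imp_subgroup by blast
  interpret T: normal T "G\<lparr>carrier := R\<rparr>"
    using normal_restrict_supergroup[OF R T] .
  interpret Q: group "G\<lparr>carrier := R\<rparr> Mod T" by (rule T.factorgroup_is_group)
  have car: "carrier (G\<lparr>carrier := R\<rparr> Mod T) = (\<lambda>x. T #> x) ` R"
    by (simp add: carrier_FactGroup)
  have "(T #> x) [^]\<^bsub>G\<lparr>carrier := R\<rparr> Mod T\<^esub> order (G\<lparr>carrier := R\<rparr> Mod T) = \<one>\<^bsub>G\<lparr>carrier := R\<rparr> Mod T\<^esub>"
    using x car by (intro Q.pow_order_eq_1) auto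
  then have "T #> (x [^] card ((\<lambda>x. T #> x) ` R)) = T"
    using T.FactGroup_pow[of x] x car by (simp add: order_def flip: nat_pow_consistent)
  moreover have "x \<in> carrier G" using x R subgroup.subset by blast
  ultimately show ?thesis
    using rcos_self[OF _ sT, of "x [^] card ((\<lambda>x. T #> x) ` R)"] by simp
qed

lemma normal_commutator_mem:
  assumes T: "T \<lhd> G" and x: "x \<in> T" and g: "g \<in> carrier G"
  shows "x \<otimes> g \<otimes> inv x \<otimes> inv g \<in> T" "g \<otimes> x \<otimes> inv g \<otimes> inv x \<in> T"
proof -
  have sT: "subgroup T G" using T normal_imp_subgroup by blast
  have xG: "x \<in> carrier G" using x subgroup.mem_carrier[OF sT] by blast
  have "g \<otimes> inv x \<otimes> inv g \<in> T" "g \<otimes> x \<otimes> inv g \<in> T"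
    using T g x normal.inv_op_closed2 subgroup.m_inv_closed[OF sT] by metis+
  then have "x \<otimes> (g \<otimes> inv x \<otimes> inv g) \<in> T" "g \<otimes> x \<otimes> inv g \<otimes> inv x \<in> T"
    using x subgroup.m_closed[OF sT] subgroup.m_inv_closed[OF sT] by blast+
  then show "x \<otimes> g \<otimes> inv x \<otimes> inv g \<in> T" "g \<otimes> x \<otimes> inv g \<otimes> inv x \<in> T"
    using xG g by (simp_all add: m_assoc)
qed

text \<open>A normal \<open>p\<close>-subgroup \<open>P\<close> acting on \<open>R/T\<close> has a nontrivial fixed point if \<open>p\<close> divides \<open>|R/T|\<close>,
  and the preimage of the fixed points is all of \<open>R\<close>.  If \<open>p\<close> does not divide \<open>|R/T|\<close>, then
  \<open>R \<inter> P \<subseteq> T\<close>.\<close>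

lemma normal_p_subgroup_centralizes_chief_factor:
  assumes fin: "finite (carrier G)" and p: "Factorial_Ring.prime p"
    and P: "P \<lhd> G" "card P = p ^ k"
    and R: "R \<lhd> G" and T: "T \<lhd> G" "T \<subset> R"
    and max: "\<And>U. \<lbrakk>U \<lhd> G; T \<subset> U; U \<subseteq> R\<rbrakk> \<Longrightarrow> U = R"
    and x: "x \<in> R" and g: "g \<in> P"
  shows "x \<otimes> g \<otimes> inv x \<otimes> inv g \<in> T"
proof -
  have sP: "subgroup P G" and sR: "subgroup R G" and sT: "subgroup T G"
    using P R T normal_imp_subgroup by blast+
  have subP: "P \<subseteq> carrier G" and subR: "R \<subseteq> carrier G" and subT: "T \<subseteq> carrier G"
    using sP sR sT by (simp_all add: subgroup.subset)
  interpret T: normal T G by fact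
  interpret P: group "G\<lparr>carrier := P\<rparr>" by (rule subgroup_imp_group) fact
  let ?E = "(\<lambda>x. T #> x) ` R"
  have xG: "x \<in> carrier G" and gG: "g \<in> carrier G" using x g subR subP by auto
  show ?thesis
  proof (cases "p dvd card ?E")
    case False
    let ?c = "x \<otimes> g \<otimes> inv x \<otimes> inv g"
    have "?c \<in> P" "?c \<in> R"
      using normal_commutator_mem[OF P(1) g xG] normal_commutator_mem[OF R x gG] by blast+
    then have "?c [^] card P = \<one>" "?c [^] card ?E \<in> T"
      using pow_card_subgroup[OF fin sP] pow_card_rcosets_mem[OF fin sR T(1)] T(2) by blast+
    moreover have "coprime p (card ?E)"
      using False p prime_imp_coprime by blast
    then have "coprime (card P) (card ?E)" using P(2) by simp
    ultimately show ?thesis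
      using coprime_pow_mem[OF sT, of ?c "card P" "card ?E"] xG gG T.one_closed by simp
  next
    case True
    \<comment> \<open>This is conjugation by \<open>h\<close> on the cosets of \<open>T\<close>. As
      a product of cosets it involves no choice of representatives.\<close>
    define f where "f = (\<lambda>h C. (T #> h) <#> C <#> (T #> inv h))"
    have f: "f h (T #> a) = T #> (h \<otimes> a \<otimes> inv h)" if "h \<in> carrier G" "a \<in> carrier G" for h a
      using that by (simp add: f_def T.rcos_sum)
    have conjR: "h \<otimes> a \<otimes> inv h \<in> R" if "h \<in> carrier G" "a \<in> R" for h a
      using normal.inv_op_closed2[OF R] that by blast
    have act: "group_action (G\<lparr>carrier := P\<rparr>) ?E (\<lambda>h. restrict (f h) ?E)"
    proof (rule group_actionI[OF P.is_group])
      fix h C assume h: "h \<in> carrier (G\<lparr>carrier := P\<rparr>)" and C: "C \<in> ?E"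
      then obtain a where "a \<in> R" "C = T #> a" by blast
      then show "f h C \<in> ?E" using f[of h a] conjR[of h a] h subP subR by auto
    next
      fix C assume "C \<in> ?E"
      then obtain a where "a \<in> R" "C = T #> a" by blast
      moreover have "a \<in> carrier G" using \<open>a \<in> R\<close> subR by auto
      ultimately show "f \<one>\<^bsub>G\<lparr>carrier := P\<rparr>\<^esub> C = C" using f[of \<one> a] by simp
    next
      fix h k C assume hk: "h \<in> carrier (G\<lparr>carrier := P\<rparr>)" "k \<in> carrier (G\<lparr>carrier := P\<rparr>)" and "C \<in> ?E"
      then obtain a where a: "a \<in> R" "C = T #> a" by blast
      have aG: "a \<in> carrier G" and hG: "h \<in> carrier G" and kG: "k \<in> carrier G"
        using a hk subR subP by auto
      have "f h (f k C) = T #> (h \<otimes> (k \<otimes> a \<otimes> inv k) \<otimes> inv h)"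
        using a f aG hG kG by simp
      also have "h \<otimes> (k \<otimes> a \<otimes> inv k) \<otimes> inv h = h \<otimes> k \<otimes> a \<otimes> inv (h \<otimes> k)"
        using aG hG kG by (simp add: m_assoc inv_mult_group)
      also have "T #> \<dots> = f (h \<otimes> k) C" using a f aG hG kG by simp
      finally show "f (h \<otimes>\<^bsub>G\<lparr>carrier := P\<rparr>\<^esub> k) C = f h (f k C)" by simp
    qed
    have finE: "finite ?E" using fin finite_subset[OF subR] by blast
    define M where "M = {C \<in> ?E. \<exists>h\<in>carrier (G\<lparr>carrier := P\<rparr>). restrict (f h) ?E C \<noteq> C}"
    have ME: "M \<subseteq> ?E" unfolding M_def by (rule Collect_restrict)
    have M: "p dvd card M"
      using group_action.p_group_dvd_card_moved[OF act p _ finE] P(2) by (simp add: order_def M_def)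
    have TE: "T \<in> ?E"
      using subgroup.one_closed[OF sR] subT by (intro image_eqI[of _ _ \<one>]) auto
    \<comment> \<open>The number of fixed cosets is divisible by \<open>p\<close>, and
      \<open>T\<close> itself is fixed, so there is a further one; it supplies an element of
      \<open>U\<close> outside \<open>T\<close>.\<close>
    have "?E - M \<noteq> {T}"
    proof
      assume "?E - M = {T}"
      then have "card ?E - card M = 1"
        using card_Diff_subset[OF finite_subset[OF ME finE] ME] by simp
      then have "p dvd 1" using True M dvd_diff_nat by metis
      then show False using p by simp
    qed
    moreover have "T \<in> ?E - M"
    proof -
      have "f h T = T" if "h \<in> P" for h
        using f[of h \<one>] that subP subT by auto
      then show ?thesis using TE by (auto simp: M_def)
    qed
    ultimately obtain C where C: "C \<in> ?E" "C \<notin> M" "C \<noteq> T" by blast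
    then obtain a where a: "a \<in> R" "C = T #> a" by blast
    have aG: "a \<in> carrier G" using a subR by auto
    have aT: "a \<notin> T" using C a aG coset_join2[OF aG sT] by blast
    have comm_a: "a \<otimes> h \<otimes> inv a \<otimes> inv h \<in> T" if h: "h \<in> P" for h
    proof -
      have hG: "h \<in> carrier G" using h subP by auto
      have "f h C = C" using C h by (auto simp: M_def)
      then have "T #> (h \<otimes> a \<otimes> inv h) = T #> a" using f aG hG a by simp
      then have "h \<otimes> a \<otimes> inv h \<in> T #> a"
        using rcos_self[OF _ sT, of "h \<otimes> a \<otimes> inv h"] aG hG by simp
      then obtain t where t: "t \<in> T" "h \<otimes> a \<otimes> inv h = t \<otimes> a" by (auto simp: r_coset_def)
      then have "h \<otimes> a \<otimes> inv h \<otimes> inv a = t" using aG T.mem_carrier by (simp add: m_assoc)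
      then have "inv (h \<otimes> a \<otimes> inv h \<otimes> inv a) \<in> T" using t by simp
      then show ?thesis using hG aG by (simp add: inv_mult_group m_assoc)
    qed
    define U where "U = {x \<in> R. \<forall>h\<in>P. x \<otimes> h \<otimes> inv x \<otimes> inv h \<in> T}"
    have UG: "y \<in> carrier G" if "y \<in> U" for y using that subR by (auto simp: U_def)
    have "subgroup U G"
    proof (rule subgroupI)
      show "U \<subseteq> carrier G" using UG by blast
      show "U \<noteq> {}" using a comm_a by (auto simp: U_def)
    next
      fix y assume y: "y \<in> U"
      have "inv y \<otimes> h \<otimes> inv (inv y) \<otimes> inv h \<in> T" if h: "h \<in> P" for h
      proof -
        have G: "y \<in> carrier G" "h \<in> carrier G" using UG y h subP by auto
        have "y \<otimes> h \<otimes> inv y \<otimes> inv h \<in> T" using y h by (simp add: U_def)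
        then have "inv y \<otimes> inv (y \<otimes> h \<otimes> inv y \<otimes> inv h) \<otimes> y \<in> T"
          using T.inv_op_closed1 G by blast
        moreover have "inv y \<otimes> inv (y \<otimes> h \<otimes> inv y \<otimes> inv h) \<otimes> y = inv y \<otimes> h \<otimes> inv (inv y) \<otimes> inv h"
          using G by (simp add: inv_mult_group m_assoc)
        ultimately show ?thesis by simp
      qed
      then show "inv y \<in> U" using y subgroup.m_inv_closed[OF sR] by (simp add: U_def)
    next
      fix y z assume y: "y \<in> U" and z: "z \<in> U"
      have "y \<otimes> z \<otimes> h \<otimes> inv (y \<otimes> z) \<otimes> inv h \<in> T" if h: "h \<in> P" for h
      proof -
        have G: "y \<in> carrier G" "z \<in> carrier G" "h \<in> carrier G" using UG y z h subP by auto
        have "y \<otimes> (z \<otimes> h \<otimes> inv z \<otimes> inv h) \<otimes> inv y \<in> T" "y \<otimes> h \<otimes> inv y \<otimes> inv h \<in> T"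
          using y z h T.inv_op_closed2 G by (simp_all add: U_def)
        then have "y \<otimes> (z \<otimes> h \<otimes> inv z \<otimes> inv h) \<otimes> inv y \<otimes> (y \<otimes> h \<otimes> inv y \<otimes> inv h) \<in> T" by simp
        moreover have "inv y \<otimes> (y \<otimes> w) = w" "inv h \<otimes> (h \<otimes> w) = w" if "w \<in> carrier G" for w
          using that G by (simp_all flip: m_assoc)
        ultimately show ?thesis using G by (simp add: inv_mult_group m_assoc)
      qed
      then show "y \<otimes> z \<in> U" using y z subgroup.m_closed[OF sR] by (simp add: U_def)
    qed
    then have "U \<lhd> G"
    proof (rule normal_invI)
      fix k y assume k: "k \<in> carrier G" and y: "y \<in> U"
      have "(k \<otimes> y \<otimes> inv k) \<otimes> h \<otimes> inv (k \<otimes> y \<otimes> inv k) \<otimes> inv h \<in> T" if h: "h \<in> P" for h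
      proof -
        have G: "y \<in> carrier G" "h \<in> carrier G" using UG y h subP by auto
        have canc: "inv k \<otimes> (k \<otimes> w) = w" "k \<otimes> (inv k \<otimes> w) = w" if "w \<in> carrier G" for w
          using that k by (simp_all flip: m_assoc)
        \<comment> \<open>The commutator of \<open>k \<otimes> y \<otimes> inv k\<close> with
          \<open>h\<close> is the conjugate by \<open>k\<close> of the commutator of
          \<open>y\<close> with \<open>inv k \<otimes> h \<otimes> k\<close>; normality of
          \<open>P\<close> keeps the latter element in \<open>P\<close>.\<close>
        have "inv k \<otimes> h \<otimes> k \<in> P" using normal.inv_op_closed1[OF P(1) k h] .
        then have "k \<otimes> (y \<otimes> (inv k \<otimes> h \<otimes> k) \<otimes> inv y \<otimes> inv (inv k \<otimes> h \<otimes> k)) \<otimes> inv k \<in> T"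
          using y T.inv_op_closed2[OF k] by (simp add: U_def)
        then show ?thesis using G k by (simp add: inv_mult_group m_assoc canc)
      qed
      then show "k \<otimes> y \<otimes> inv k \<in> U" using y k conjR by (simp add: U_def)
    qed
    moreover have "T \<subset> U"
    proof
      show "T \<subseteq> U" using normal_commutator_mem(1)[OF T(1)] T(2) subP by (auto simp: U_def)
      show "T \<noteq> U" using a aT comm_a by (auto simp: U_def)
    qed
    ultimately have "U = R" using max by (auto simp: U_def)
    then show ?thesis using x g by (auto simp: U_def)
  qed
qed

text \<open>Below any nontrivial normal subgroup \<open>R\<close> take a maximal proper one
  \<open>T\<close> that is normal in the group. The elements acting trivially on \<open>R\<close>
  modulo \<open>T\<close> form a subgroup containing every Sylow subgroup, so \<open>R\<close>
  modulo \<open>T\<close> is central. With \<open>R\<close> a term of the lower central series, the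
  next term lies in \<open>T\<close>.\<close>

theorem nilpotent_if_sylow_normal:
  assumes fin: "finite (carrier G)"
    and normal: "\<And>p P. \<lbrakk>Factorial_Ring.prime p; sylow_subgroup p P\<rbrakk> \<Longrightarrow> P \<lhd> G"
  shows "nilpotent_group G"
proof -
  have descend: "\<exists>T. T \<lhd> G \<and> T \<subset> R \<and> (\<forall>x\<in>R. \<forall>g\<in>carrier G. x \<otimes> g \<otimes> inv x \<otimes> inv g \<in> T)"
    if R: "R \<lhd> G" "R \<noteq> {\<one>}" for R
  proof -
    have sR: "subgroup R G" using R normal_imp_subgroup by blast
    let ?\<T> = "{T. T \<lhd> G \<and> T \<subset> R}"
    have "finite (Pow (carrier G))" using fin by simp
    moreover have "?\<T> \<subseteq> Pow (carrier G)"
      using subgroup.subset[OF sR] by blast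
    ultimately have finT: "finite ?\<T>" by (rule rev_finite_subset)
    have "{\<one>} \<in> ?\<T>"
      using one_is_normal R subgroup.one_closed[OF sR] by auto
    with finT obtain T where T: "T \<in> ?\<T>" "\<And>U. \<lbrakk>U \<in> ?\<T>; T \<subseteq> U\<rbrakk> \<Longrightarrow> T = U"
      using finite_has_maximal[OF finT] by (metis (no_types, lifting) empty_iff)
    have nT: "T \<lhd> G" "T \<subset> R" using T(1) by auto
    have sT: "subgroup T G" using nT(1) by (rule normal_imp_subgroup)
    interpret T: normal T G by fact
    have max: "U = R" if "U \<lhd> G" "T \<subset> U" "U \<subseteq> R" for U
      using T(2)[of U] that by blast
    define C where "C = {g \<in> carrier G. \<forall>x\<in>R. x \<otimes> g \<otimes> inv x \<otimes> inv g \<in> T}"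
    have subR: "R \<subseteq> carrier G" using sR by (rule subgroup.subset)
    have "subgroup C G"
    proof (rule subgroupI)
      show "C \<subseteq> carrier G" by (auto simp: C_def)
      have "\<one> \<in> C" using subR by (auto simp: C_def)
      then show "C \<noteq> {}" by blast
    next
      fix g assume g: "g \<in> C"
      have "x \<otimes> inv g \<otimes> inv x \<otimes> inv (inv g) \<in> T" if x: "x \<in> R" for x
      proof -
        have G: "x \<in> carrier G" "g \<in> carrier G" using x g subR by (auto simp: C_def)
        have "x \<otimes> g \<otimes> inv x \<otimes> inv g \<in> T" using x g by (simp add: C_def)
        then have "inv g \<otimes> inv (x \<otimes> g \<otimes> inv x \<otimes> inv g) \<otimes> g \<in> T"
          using T.inv_op_closed1 G by blast
        moreover have "inv g \<otimes> (g \<otimes> w) = w" if "w \<in> carrier G" for w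
          using that G by (simp flip: m_assoc)
        ultimately show ?thesis using G by (simp add: inv_mult_group m_assoc)
      qed
      then show "inv g \<in> C" using g by (simp add: C_def)
    next
      fix g h assume g: "g \<in> C" and h: "h \<in> C"
      have "x \<otimes> (g \<otimes> h) \<otimes> inv x \<otimes> inv (g \<otimes> h) \<in> T" if x: "x \<in> R" for x
      proof -
        have G: "x \<in> carrier G" "g \<in> carrier G" "h \<in> carrier G" using x g h subR by (auto simp: C_def)
        have "g \<otimes> (x \<otimes> h \<otimes> inv x \<otimes> inv h) \<otimes> inv g \<in> T" "x \<otimes> g \<otimes> inv x \<otimes> inv g \<in> T"
          using x g h T.inv_op_closed2 G by (simp_all add: C_def)
        then have "(x \<otimes> g \<otimes> inv x \<otimes> inv g) \<otimes> (g \<otimes> (x \<otimes> h \<otimes> inv x \<otimes> inv h) \<otimes> inv g) \<in> T" by simp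
        moreover have "inv g \<otimes> (g \<otimes> w) = w" "inv x \<otimes> (x \<otimes> w) = w" if "w \<in> carrier G" for w
          using that G by (simp_all flip: m_assoc)
        ultimately show ?thesis using G by (simp add: inv_mult_group m_assoc)
      qed
      then show "g \<otimes> h \<in> C" using g h by (simp add: C_def)
    qed
    moreover have "\<exists>P. sylow_subgroup p P \<and> P \<subseteq> C" if p: "Factorial_Ring.prime p" for p
    proof -
      obtain P where P: "sylow_subgroup p P" using sylow_subgroup_exists[OF fin p] by blast
      have "P \<subseteq> C"
        using normal_p_subgroup_centralizes_chief_factor[OF fin p normal[OF p P] _ R(1) nT max]
          P sylow_subgroup_subset[OF P] by (auto simp: C_def sylow_subgroup_def)
      then show ?thesis using P by blast
    qed
    ultimately have "C = carrier G" using eq_carrier_if_contains_sylow[OF fin] by blast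
    then have "\<forall>x\<in>R. \<forall>g\<in>carrier G. x \<otimes> g \<otimes> inv x \<otimes> inv g \<in> T" by (auto simp: C_def)
    then show ?thesis using nT by blast
  qed
  have step: "lower_central G (Suc n) \<subset> lower_central G n" if "lower_central G n \<noteq> {\<one>}" for n
  proof -
    obtain T where T: "T \<lhd> G" "T \<subset> lower_central G n"
      "\<forall>x\<in>lower_central G n. \<forall>g\<in>carrier G. x \<otimes> g \<otimes> inv x \<otimes> inv g \<in> T"
      using descend[OF lower_central_normal \<open>lower_central G n \<noteq> {\<one>}\<close>] by blast
    have "lower_central G (Suc n) \<subseteq> T"
      unfolding lower_central.simps using T normal_imp_subgroup by (intro generate_subgroup_incl) auto
    then show ?thesis using T by blast
  qed
  have "\<exists>n. lower_central G n = {\<one>}"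
  proof (rule ccontr)
    assume "\<not> ?thesis"
    then have dec: "lower_central G (Suc n) \<subset> lower_central G n" for n using step by blast
    \<comment> \<open>A series that never becomes trivial loses at least one element at each step;
      at \<open>n = order G\<close> not even \<open>\<one>\<close> would be left.\<close>
    have "card (lower_central G n) + n \<le> order G" for n
    proof (induction n)
      case (Suc n)
      have "card (lower_central G (Suc n)) < card (lower_central G n)"
        using dec finite_subset[OF lower_central_subset fin] psubset_card_mono by blast
      then show ?case using Suc by linarith
    qed (simp add: order_def)
    from this[of "order G"] have "card (lower_central G (order G)) = 0" by simp
    then have "lower_central G (order G) = {}"
      using finite_subset[OF lower_central_subset fin] by simp
    then show False
      using subgroup.one_closed[OF normal_imp_subgroup[OF lower_central_normal]] by blast
  qed
  then show ?thesis by (simp add: nilpotent_group_def is_group)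
qed

subsection \<open>ES-partitions of nilpotent groups\<close>

definition maximal_subgroup :: "'a set \<Rightarrow> bool" where
  "maximal_subgroup M \<longleftrightarrow> subgroup M G \<and> M \<noteq> carrier G \<and>
     (\<forall>H. subgroup H G \<longrightarrow> M \<subseteq> H \<longrightarrow> H = M \<or> H = carrier G)"

lemma maximal_subgroup_exists:
  assumes fin: "finite (carrier G)" and H: "subgroup H G" "H \<noteq> carrier G"
  shows "\<exists>M. maximal_subgroup M \<and> H \<subseteq> M"
proof -
  let ?A = "{K. subgroup K G \<and> K \<noteq> carrier G \<and> H \<subseteq> K}"
  have "?A \<subseteq> Pow (carrier G)" by (auto dest: subgroup.mem_carrier)
  then have "finite ?A" using fin by (simp add: finite_subset)
  then obtain M where M: "M \<in> ?A" "\<forall>K\<in>?A. M \<subseteq> K \<longrightarrow> M = K"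
    using finite_has_maximal[of ?A] H by (metis (mono_tags, lifting) empty_iff mem_Collect_eq order_refl)
  have "K = M \<or> K = carrier G" if "subgroup K G" "M \<subseteq> K" for K
  proof (cases "K = carrier G")
    case False
    then have "K \<in> ?A" using that M(1) by blast
    then show ?thesis using M(2) that by blast
  qed simp
  then show ?thesis using M(1) unfolding maximal_subgroup_def by blast
qed

lemma maximal_subgroup_normal_or_self_normalizing:
  assumes "maximal_subgroup M"
  shows "M \<lhd> G \<or> normalizer G M = M"
proof -
  have sM: "subgroup M G" using assms by (simp add: maximal_subgroup_def)
  have "subgroup (normalizer G M) G"
    using normalizer_imp_subgroup[OF subgroup.subset[OF sM]] .
  then have "normalizer G M = M \<or> normalizer G M = carrier G"
    using assms subgroup_subset_normalizer[OF sM] by (simp add: maximal_subgroup_def)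
  then show ?thesis using normal_iff_normalizer[OF sM] by blast
qed

lemma nilpotent_maximal_subgroup_normal:
  assumes "nilpotent_group G" "finite (carrier G)" "maximal_subgroup M"
  shows "M \<lhd> G"
  using nilpotent_normalizer_grows[OF assms(1,2), of M] assms(3)
    maximal_subgroup_normal_or_self_normalizing[OF assms(3)]
  by (auto simp: maximal_subgroup_def)

section \<open>Subgroups of factor groups and normal subgroups of prime index\<close>

text \<open>A subgroup \<open>A\<close> of \<open>G Mod N\<close> is a set of cosets, so
  \<open>\<Union>A\<close> is its preimage.\<close>

lemma card_Union_subgroup_FactGroup:
  assumes fin: "finite (carrier G)" and N: "N \<lhd> G" and A: "subgroup A (G Mod N)"
  shows "card (\<Union>A) = card A * card N"
proof -
  interpret N: normal N G by fact
  have sub: "A \<subseteq> rcosets N" using subgroup.subset[OF A] by (simp add: FactGroup_def)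
  have fA: "finite (\<Union>A)"
    using fin finite_subset subgroup.subset[OF N.factgroup_subgroup_union_subgroup[OF A]] by blast
  have "card N * card A = card (\<Union>A)"
  proof (rule card_partition)
    show "finite A" using fA by (rule finite_UnionD)
    show "\<And>c. c \<in> A \<Longrightarrow> card c = card N"
      using sub card_rcosets_equal N.subset by (metis subsetD)
    show "\<And>c1 c2. \<lbrakk>c1 \<in> A; c2 \<in> A; c1 \<noteq> c2\<rbrakk> \<Longrightarrow> c1 \<inter> c2 = {}"
      using rcos_disjoint[OF N.is_subgroup] sub by (auto simp: pairwise_def disjnt_def)
  qed (rule fA)
  then show ?thesis by (simp only: mult.commute)
qed

lemma normal_subset_Union_subgroup_FactGroup:
  assumes "N \<lhd> G" "subgroup A (G Mod N)"
  shows "N \<subseteq> \<Union>A"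
  using subgroup.one_closed[OF assms(2)] by auto

text \<open>For a prime divisor \<open>p\<close> of the index, the factor group has a subgroup of
  order \<open>p\<close>. Its preimage lies properly above \<open>M\<close>, hence is
  everything.\<close>

lemma normal_maximal_subgroup_index_prime:
  assumes fin: "finite (carrier G)" and M: "M \<lhd> G" "maximal_subgroup M"
  shows "Factorial_Ring.prime (card (rcosets M))"
proof -
  interpret M: normal M G by fact
  interpret Q: group "G Mod M" by (rule M.factorgroup_is_group)
  have idx: "card (rcosets M) * card M = order G" by (rule lagrange) (rule M.is_subgroup)
  have posM: "card M > 0" using card_subgroup_pos fin M.is_subgroup by blast
  have "card M < order G"
    unfolding order_def using fin M(2) M.subset by (intro psubset_card_mono) (auto simp: maximal_subgroup_def)
  then have "card (rcosets M) \<noteq> 1" using idx by auto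
  then obtain p where p: "Factorial_Ring.prime p" "p dvd card (rcosets M)"
    using prime_factor_nat by blast
  have finQ: "finite (carrier (G Mod M))" using fin by (simp add: carrier_FactGroup)
  \<comment> \<open>The existence theorem applies to any prime power dividing the order; with
    exponent 1 it is Cauchy's theorem.\<close>
  obtain m where "order (G Mod M) = p ^ 1 * m" using p(2) by (auto simp: order_def FactGroup_def)
  then have "sylow (G Mod M) p 1 m"
    unfolding sylow_eq sylow_axioms_def using p finQ Q.is_group by simp
  from sylow.sylow_thm[OF this] obtain B where B: "subgroup B (G Mod M)" "card B = p" by auto
  have cB: "card (\<Union>B) = p * card M" using card_Union_subgroup_FactGroup[OF fin M(1) B(1)] B(2) by simp
  have "\<Union>B \<noteq> M" using cB posM p(1) prime_gt_1_nat[of p] by auto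
  then have "\<Union>B = carrier G"
    using M(2) M.factgroup_subgroup_union_subgroup[OF B(1)] normal_subset_Union_subgroup_FactGroup[OF M(1) B(1)]
    by (auto simp: maximal_subgroup_def)
  then have "p * card M = order G" using cB by (simp add: order_def)
  then have "p * card M = card (rcosets M) * card M" using idx by (simp only:)
  then have "p = card (rcosets M)" using posM by simp
  then show ?thesis using p(1) by simp
qed

lemma pow_index_mem:
  assumes "finite (carrier G)" "N \<lhd> G" "x \<in> carrier G"
  shows "x [^] card (rcosets N) \<in> N"
proof -
  have "(\<lambda>x. N #> x) ` carrier G = rcosets N" by (auto simp: RCOSETS_def)
  then show ?thesis
    using pow_card_rcosets_mem[OF assms(1) subgroup_self assms(2) _ assms(3)]
      subgroup.subset[OF normal_imp_subgroup[OF assms(2)]] by simp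
qed

text \<open>The image of \<open>x\<close> is a nontrivial element of a group of prime order, so its
  order is that prime.\<close>

lemma pow_mem_iff_index_dvd:
  assumes fin: "finite (carrier G)" and N: "N \<lhd> G" "Factorial_Ring.prime (card (rcosets N))"
    and x: "x \<in> carrier G" "x \<notin> N"
  shows "x [^] k \<in> N \<longleftrightarrow> card (rcosets N) dvd k"
proof
  have sN: "subgroup N G" using N(1) by (rule normal_imp_subgroup)
  assume "x [^] k \<in> N"
  then show "card (rcosets N) dvd k"
    using coprime_pow_mem[OF sN x(1) pow_index_mem[OF fin N(1) x(1)]] x(2) prime_imp_coprime[OF N(2)]
    by blast
next
  have sN: "subgroup N G" using N(1) by (rule normal_imp_subgroup)
  interpret N: group "G\<lparr>carrier := N\<rparr>" by (rule subgroup_imp_group) fact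
  assume "card (rcosets N) dvd k"
  then obtain m where m: "k = card (rcosets N) * m" by blast
  have "(x [^] card (rcosets N)) [^] m \<in> N"
    using N.nat_pow_closed[of "x [^] card (rcosets N)" m] pow_index_mem[OF fin N(1) x(1)]
    by (simp flip: nat_pow_consistent)
  then show "x [^] k \<in> N" using m x by (simp add: nat_pow_pow)
qed

text \<open>The coprimality of the indices makes this an instance of the Chinese remainder theorem.\<close>

lemma element_avoiding_normal_subgroups:
  assumes fin: "finite (carrier G)" and "finite \<M>"
    and "\<And>M. M \<in> \<M> \<Longrightarrow> M \<lhd> G \<and> Factorial_Ring.prime (card (rcosets M))"
    and "inj_on (\<lambda>M. card (rcosets M)) \<M>"
  shows "\<exists>x\<in>carrier G. \<forall>M\<in>\<M>. x \<notin> M"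
  using assms(2-4)
proof (induction \<M> rule: finite_induct)
  case (insert M F)
  obtain x where x: "x \<in> carrier G" "\<forall>N\<in>F. x \<notin> N" using insert by (auto simp: inj_on_insert)
  have nM: "M \<lhd> G" and pM: "Factorial_Ring.prime (card (rcosets M))" using insert.prems by auto
  have sM: "subgroup M G" using nM by (rule normal_imp_subgroup)
  show ?case
  proof (cases "x \<in> M")
    case True
    have "M \<noteq> carrier G"
    proof
      assume "M = carrier G"
      then have "card (rcosets M) * order G = order G"
        using lagrange[OF sM] by (simp add: order_def)
      moreover have "order G > 0" using fin order_gt_0_iff_finite by blast
      ultimately have "card (rcosets M) = 1" by simp
      then show False using pM by simp
    qed
    then obtain z where z: "z \<in> carrier G" "z \<notin> M" using subgroup.subset[OF sM] by blast
    \<comment> \<open>With this exponent, \<open>z [^] n\<close> lies in every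
      \<open>N \<in> F\<close> but stays outside \<open>M\<close>, whose index is a different prime.
      Multiplying \<open>x\<close> by it changes the class of \<open>x\<close> modulo
      \<open>M\<close> only.\<close>
    define n where "n = (\<Prod>N\<in>F. card (rcosets N))"
    define w where "w = z [^] n"
    have wG: "w \<in> carrier G" using z by (simp add: w_def)
    have "\<not> card (rcosets M) dvd n"
    proof
      assume "card (rcosets M) dvd n"
      then obtain N where N: "N \<in> F" "card (rcosets M) dvd card (rcosets N)"
        using prime_dvd_prod_iff[OF insert.hyps(1) pM] by (auto simp: n_def)
      then have "card (rcosets M) = card (rcosets N)"
        using insert.prems(1)[of N] pM primes_dvd_imp_eq by blast
      then show False using insert.prems(2) insert.hyps(2) N(1) by (auto simp: inj_on_def)
    qed
    then have wM: "w \<notin> M" using pow_mem_iff_index_dvd[OF fin nM pM z] by (simp add: w_def)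
    have wN: "w \<in> N" if N: "N \<in> F" for N
    proof (cases "z \<in> N")
      case False
      have "card (rcosets N) dvd n" 
        using dvd_prodI[OF insert.hyps(1) N, of "\<lambda>N. card (rcosets N)"] by (simp add: n_def)
      then show ?thesis
        using pow_mem_iff_index_dvd[OF fin _ _ z(1) False] insert.prems(1)[of N] N by (simp add: w_def)
    next
      case True
      have sN: "subgroup N G" using insert.prems(1)[of N] N normal_imp_subgroup by blast
      interpret N: group "G\<lparr>carrier := N\<rparr>" using sN by (rule subgroup_imp_group)
      show ?thesis using N.nat_pow_closed[of z n] True by (simp add: w_def flip: nat_pow_consistent)
    qed
    have "x \<otimes> w \<notin> M"
    proof
      assume "x \<otimes> w \<in> M"
      then have "inv x \<otimes> (x \<otimes> w) \<in> M"
        using True subgroup.m_closed[OF sM] subgroup.m_inv_closed[OF sM] by blast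
      then show False using wM x wG by (simp flip: m_assoc)
    qed
    moreover have "x \<otimes> w \<notin> N" if N: "N \<in> F" for N
    proof
      assume "x \<otimes> w \<in> N"
      moreover have sN: "subgroup N G" using insert.prems(1)[of N] N normal_imp_subgroup by blast
      ultimately have "x \<otimes> w \<otimes> inv w \<in> N"
        using wN[OF N] subgroup.m_closed[OF sN] subgroup.m_inv_closed[OF sN] by blast
      then show False using x N wG by (simp add: m_assoc)
    qed
    ultimately show ?thesis using x wG by (intro bexI[of _ "x \<otimes> w"]) auto
  next
    case False
    then show ?thesis using x by blast
  qed
qed auto

text \<open>Otherwise the subgroup generated by \<open>x\<close> would be proper and lie in a
  maximal one. Read backwards: the maximal subgroups of a noncyclic group cover it.\<close>

lemma cyclic_if_avoids_maximal_subgroups: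
  assumes "finite (carrier G)" "x \<in> carrier G" "\<And>M. maximal_subgroup M \<Longrightarrow> x \<notin> M"
  shows "cyclic_group G"
proof -
  have "subgroup (generate G {x}) G" using assms generate_is_subgroup by simp
  moreover have "x \<in> generate G {x}" by (simp add: generate.incl)
  ultimately have "generate G {x} = carrier G"
    using maximal_subgroup_exists[OF assms(1)] assms(3) by blast
  then have "subgroup_generated G {x} = G" using assms(2) by (simp add: subgroup_generated_def)
  then show ?thesis using assms(2) by (auto simp: cyclic_group_def)
qed

lemma finite_maximal_subgroups: "finite (carrier G) \<Longrightarrow> finite {M. maximal_subgroup M}"
  by (rule finite_subset[of _ "Pow (carrier G)"]) (auto simp: maximal_subgroup_def dest: subgroup.mem_carrier)

text \<open>Modulo the intersection \<open>N\<close> every \<open>p\<close>-th power is trivial,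
  because it lies in both \<open>M\<close> and \<open>K\<close>. So each element outside
  \<open>N\<close> generates a subgroup of order \<open>p\<close> in the factor group, and two
  different subgroups of order \<open>p\<close> meet trivially.\<close>

lemma ES_partition_of_normal_maximal_subgroups:
  assumes fin: "finite (carrier G)"
    and M: "maximal_subgroup M" "M \<lhd> G" and K: "maximal_subgroup K" "K \<lhd> G"
    and ne: "M \<noteq> K" and idx: "card (rcosets M) = card (rcosets K)"
  shows "\<exists>\<H>. ES_partition G (M \<inter> K) \<H>"
proof -
  define N where "N = M \<inter> K"
  define p where "p = card (rcosets M)"
  have p: "Factorial_Ring.prime p" using normal_maximal_subgroup_index_prime[OF fin M(2,1)] by (simp add: p_def)
  have sM: "subgroup M G" and sK: "subgroup K G" using M K by (simp_all add: maximal_subgroup_def)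
  have nN: "N \<lhd> G" unfolding N_def using M(2) K(2) by (rule normal_subgroup_intersect)
  interpret N: normal N G by (rule nN)
  interpret Q: group "G Mod N" by (rule N.factorgroup_is_group)
  have finM: "finite M" using fin finite_subset[OF subgroup.subset[OF sM]] by blast
  \<comment> \<open>This gives \<open>p * card N < order G\<close>, which makes the members of the
    family proper subgroups.\<close>
  have "N \<noteq> M"
  proof
    assume "N = M"
    then have "M \<subseteq> K" by (auto simp: N_def)
    then show False using M(1) K(1) ne sK by (auto simp: maximal_subgroup_def)
  qed
  then have "card N < card M" using finM by (intro psubset_card_mono) (auto simp: N_def)
  then have lt: "p * card N < order G"
    using lagrange[OF sM] p prime_gt_0_nat by (metis p_def mult_less_mono2)
  have posN: "card N > 0" using card_subgroup_pos[OF fin N.is_subgroup] .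
  define \<H> where "\<H> = {H. subgroup H G \<and> N \<subseteq> H \<and> card H = p * card N}"
  have finH: "finite H" if "H \<in> \<H>" for H
  proof -
    have "subgroup H G" using that by (simp add: \<H>_def)
    then show ?thesis using fin finite_subset[OF subgroup.subset] by blast
  qed
  have ex: "\<exists>H\<in>\<H>. x \<in> H" if x: "x \<in> carrier G" "x \<notin> N" for x
  proof -
    let ?B = "generate (G Mod N) {N #> x}"
    have car: "N #> x \<in> carrier (G Mod N)" using x by (simp add: carrier_FactGroup)
    have B: "subgroup ?B (G Mod N)" using car by (intro Q.generate_is_subgroup) auto
    have "x [^] p \<in> N"
      using pow_index_mem[OF fin M(2) x(1)] pow_index_mem[OF fin K(2) x(1)] idx by (simp add: N_def p_def)
    then have "(N #> x) [^]\<^bsub>G Mod N\<^esub> p = \<one>\<^bsub>G Mod N\<^esub>"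
      using N.FactGroup_pow x(1) by (simp add: coset_join2 N.is_subgroup)
    then have "Q.ord (N #> x) dvd p" using Q.pow_eq_id[OF car] by blast
    moreover have "Q.ord (N #> x) \<noteq> 1"
      using Q.ord_eq_1[OF car] rcos_self[OF x(1) N.is_subgroup] x(2) by auto
    ultimately have "Q.ord (N #> x) = p" using p by (auto simp: prime_nat_iff)
    then have "card ?B = p" using Q.generate_pow_card[OF car] by simp
    then have "card (\<Union>?B) = p * card N" using card_Union_subgroup_FactGroup[OF fin nN B] by simp
    then have "\<Union>?B \<in> \<H>"
      using N.factgroup_subgroup_union_subgroup[OF B] normal_subset_Union_subgroup_FactGroup[OF nN B]
      by (simp add: \<H>_def)
    moreover have "x \<in> \<Union>?B"
      using rcos_self[OF x(1) N.is_subgroup] generate.incl[of "N #> x" "{N #> x}"] by blast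
    ultimately show ?thesis by blast
  qed
  have "N \<noteq> carrier G" using lt p prime_gt_0_nat[OF p] posN by (auto simp: order_def)
  then obtain z where z: "z \<in> carrier G" "z \<notin> N" using N.subset by blast
  \<comment> \<open>An element of \<open>N\<close> lies in every member, but a member must exist;
    the one through \<open>z\<close> will do.\<close>
  have cover: "\<exists>H\<in>\<H>. x \<in> H" if "x \<in> carrier G" for x
    using ex[OF that] ex[OF z] by (cases "x \<in> N") (auto simp: \<H>_def)
  \<comment> \<open>The index \<open>c\<close> of \<open>N\<close> in the intersection divides the
    prime \<open>p\<close>, and \<open>c = p\<close> would make both members equal to their
    intersection.\<close>
  have inter: "H \<inter> L = N" if H: "H \<in> \<H>" and L: "L \<in> \<H>" and HL: "H \<noteq> L" for H L
  proof -
    have sub: "subgroup (H \<inter> L) G" "N \<subseteq> H \<inter> L"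
      using H L subgroups_Inter_pair by (auto simp: \<H>_def)
    obtain c where c: "card (H \<inter> L) = c * card N"
      using card_subgroup_dvd[OF N.is_subgroup sub] by (metis dvd_div_mult_self)
    have "c * card N dvd p * card N"
      using card_subgroup_dvd[OF sub(1), of H] H c by (auto simp: \<H>_def)
    then have "c dvd p" using posN by simp
    moreover have "c \<noteq> p"
    proof
      assume "c = p"
      then have "H \<inter> L = H" "H \<inter> L = L"
        using card_subset_eq[OF finH[OF H], of "H \<inter> L"] card_subset_eq[OF finH[OF L], of "H \<inter> L"] c H L
        by (simp_all add: \<H>_def)
      then show False using HL by simp
    qed
    ultimately have "c = 1" using p by (auto simp: prime_nat_iff)
    then show ?thesis
      using c sub(2) finH[OF H] card_subset_eq[of "H \<inter> L" N] by simp
  qed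
  have "ES_partition G N \<H>"
    unfolding ES_partition_def strict_partition_def proper_subgroup_def
  proof (intro conjI ballI impI)
    show "finite \<H>"
      by (rule finite_subset[of _ "Pow (carrier G)"]) (use fin in \<open>auto simp: \<H>_def dest: subgroup.mem_carrier\<close>)
    have "\<Union>\<H> \<subseteq> carrier G" by (auto simp: \<H>_def dest: subgroup.mem_carrier)
    then show "carrier G = \<Union>\<H>" using cover by blast
    show "H \<noteq> carrier G" if "H \<in> \<H>" for H using that lt by (auto simp: \<H>_def order_def)
  qed (use \<open>N \<noteq> carrier G\<close> N.is_subgroup inter in \<open>auto simp: \<H>_def\<close>)
  then show ?thesis unfolding N_def by blast
qed

text \<open>If the maximal subgroups had pairwise different prime indices, some element would avoid
  all of them and generate the group. The result serves both directions: a minimal non-ES-partition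
  group cannot be nilpotent, and the proper noncyclic subgroups of a Schmidt group have
  partitions.\<close>

theorem nilpotent_noncyclic_ES_partition:
  assumes nil: "nilpotent_group G" and fin: "finite (carrier G)" and nc: "\<not> cyclic_group G"
  shows "\<exists>S \<H>. subgroup S G \<and> ES_partition G S \<H>"
proof -
  let ?\<M> = "{M. maximal_subgroup M}"
  have norm: "M \<lhd> G" if "maximal_subgroup M" for M
    using nilpotent_maximal_subgroup_normal[OF nil fin that] .
  have "\<not> inj_on (\<lambda>M. card (rcosets M)) ?\<M>"
    using element_avoiding_normal_subgroups[OF fin finite_maximal_subgroups[OF fin]]
      norm normal_maximal_subgroup_index_prime[OF fin] cyclic_if_avoids_maximal_subgroups[OF fin] nc
    by (metis mem_Collect_eq)
  then obtain M K where "maximal_subgroup M" "maximal_subgroup K" "M \<noteq> K"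
    "card (rcosets M) = card (rcosets K)"
    by (auto simp: inj_on_def)
  then obtain \<H> where "ES_partition G (M \<inter> K) \<H>"
    using ES_partition_of_normal_maximal_subgroups[OF fin] norm by blast
  moreover from this have "subgroup (M \<inter> K) G"
    unfolding ES_partition_def strict_partition_def proper_subgroup_def by (elim conjE)
  ultimately show ?thesis by blast
qed

subsection \<open>Normal maximal subgroups\<close>

lemma nilpotent_subgroup_normalizer_grows:
  assumes fin: "finite (carrier G)" and K: "subgroup K G" "nilpotent_group (G\<lparr>carrier := K\<rparr>)"
    and H: "subgroup H G" "H \<subset> K"
  shows "\<exists>x\<in>K. x \<notin> H \<and> x \<in> normalizer G H"
proof -
  interpret K: group "G\<lparr>carrier := K\<rparr>" using K(1) by (rule subgroup_imp_group)
  have subK: "K \<subseteq> carrier G" using K(1) by (rule subgroup.subset)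
  have finK: "finite (carrier (G\<lparr>carrier := K\<rparr>))" using fin subK finite_subset by simp
  have "subgroup H (G\<lparr>carrier := K\<rparr>)" using subgroup_incl[OF H(1) K(1)] H(2) by blast
  then obtain x where x: "x \<in> normalizer (G\<lparr>carrier := K\<rparr>) H" "x \<notin> H"
    using K.nilpotent_normalizer_grows[OF K(2) finK] H(2) by auto
  have HK: "H \<subseteq> carrier (G\<lparr>carrier := K\<rparr>)" using H(2) by auto
  have xK: "x \<in> K" using x K.normalizer_iff[OF HK] by simp
  then have "(\<lambda>h. x \<otimes> h \<otimes> inv x) ` H = H"
    using x K.normalizer_iff[OF HK] m_inv_consistent[OF K(1) xK] by simp
  then have "x \<in> normalizer G H"
    using normalizer_iff[OF subgroup.subset[OF H(1)]] xK subK by auto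
  then show ?thesis using x xK by blast
qed

section \<open>Conjugacy classes of subgroups\<close>

lemma conj_conj_set:
  assumes "H \<subseteq> carrier G" "a \<in> carrier G" "b \<in> carrier G"
  shows "(\<lambda>h. a \<otimes> h \<otimes> inv a) ` (\<lambda>h. b \<otimes> h \<otimes> inv b) ` H = (\<lambda>h. (a \<otimes> b) \<otimes> h \<otimes> inv (a \<otimes> b)) ` H"
  unfolding image_image
proof (rule image_cong[OF refl])
  fix h assume "h \<in> H"
  then have "h \<in> carrier G" using assms by blast
  then show "a \<otimes> (b \<otimes> h \<otimes> inv b) \<otimes> inv a = (a \<otimes> b) \<otimes> h \<otimes> inv (a \<otimes> b)"
    using assms by (simp add: m_assoc inv_mult_group)
qed

lemma conj_set_inv:
  assumes "H \<subseteq> carrier G" "a \<in> carrier G" "(\<lambda>h. a \<otimes> h \<otimes> inv a) ` H = K"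
  shows "(\<lambda>h. inv a \<otimes> h \<otimes> inv (inv a)) ` K = H"
proof -
  have "(\<lambda>h. \<one> \<otimes> h \<otimes> inv \<one>) ` H = (\<lambda>h. h) ` H"
    using assms(1) by (intro image_cong) auto
  then show ?thesis
    using conj_conj_set[of H "inv a" a] assms by auto
qed

definition conjugates :: "'a set \<Rightarrow> 'a set set" where
  "conjugates H = (\<lambda>g. (\<lambda>h. g \<otimes> h \<otimes> inv g) ` H) ` carrier G"

lemma card_conjugates_mult_normalizer:
  assumes "H \<subseteq> carrier G"
  shows "card (conjugates H) * card (normalizer G H) = order G"
proof -
  let ?f = "\<lambda>g. \<lambda>H \<in> {H. H \<subseteq> carrier G}. g <# H #> inv g"
  have "orbit G ?f H = conjugates H"
  proof -
    have "orbit G ?f H = (\<lambda>g. ?f g H) ` carrier G" by (auto simp: orbit_def)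
    also have "\<dots> = conjugates H"
      unfolding conjugates_def using assms conj_coset_eq_image[OF assms] by (intro image_cong) auto
    finally show ?thesis .
  qed
  then show ?thesis
    using group_action.orbit_stabilizer_theorem[OF action_by_conjugation_on_power_set, of H] assms
    by (simp add: normalizer_def)
qed

lemma conjugates_trans:
  assumes "M \<subseteq> carrier G" "L \<subseteq> carrier G" "K \<in> conjugates M" "K \<in> conjugates L"
  shows "L \<in> conjugates M"
proof -
  obtain a b where ab: "a \<in> carrier G" "K = (\<lambda>h. a \<otimes> h \<otimes> inv a) ` M"
    "b \<in> carrier G" "K = (\<lambda>h. b \<otimes> h \<otimes> inv b) ` L"
    using assms(3,4) by (auto simp: conjugates_def)
  have "(\<lambda>h. inv b \<otimes> h \<otimes> inv (inv b)) ` (\<lambda>h. a \<otimes> h \<otimes> inv a) ` M = L"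
    using conj_set_inv[OF assms(2) ab(3)] ab(2,4) by metis
  then have "L = (\<lambda>h. (inv b \<otimes> a) \<otimes> h \<otimes> inv (inv b \<otimes> a)) ` M"
    using conj_conj_set[OF assms(1), of "inv b" a] ab by simp
  then show ?thesis using ab by (auto simp: conjugates_def)
qed

lemma maximal_subgroup_conjugates:
  assumes M: "maximal_subgroup M" and K: "K \<in> conjugates M"
  shows "maximal_subgroup K"
proof -
  have sM: "subgroup M G" using M by (simp add: maximal_subgroup_def)
  have subM: "M \<subseteq> carrier G" using sM by (rule subgroup.subset)
  obtain a where a: "a \<in> carrier G" "(\<lambda>h. a \<otimes> h \<otimes> inv a) ` M = K"
    using K by (auto simp: conjugates_def)
  let ?c = "\<lambda>L. (\<lambda>h. inv a \<otimes> h \<otimes> inv (inv a)) ` L"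
  have sK: "subgroup K G" using subgroup_conj[OF sM a(1)] a(2) by simp
  have conjK: "?c K = M" using conj_set_inv[OF subM a] .
  have car: "?c (carrier G) = carrier G"
    using normalizer_iff[of "carrier G" "inv a"] subgroup_subset_normalizer[OF subgroup_self] a(1) by auto
  have inj: "L = L'" if "?c L = ?c L'" "L \<subseteq> carrier G" "L' \<subseteq> carrier G" for L L'
    using conj_set_inv[OF that(2) inv_closed[OF a(1)] refl] conj_set_inv[OF that(3) inv_closed[OF a(1)] refl]
      that(1) by metis
  show ?thesis unfolding maximal_subgroup_def
  proof (intro conjI allI impI)
    show "subgroup K G" by (rule sK)
    show "K \<noteq> carrier G" using conjK car M by (auto simp: maximal_subgroup_def)
  next
    fix L assume L: "subgroup L G" "K \<subseteq> L"
    have "subgroup (?c L) G" using subgroup_conj[OF L(1)] a(1) by blast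
    moreover have "M \<subseteq> ?c L" using conjK L(2) by blast
    ultimately have "?c L = ?c K \<or> ?c L = ?c (carrier G)"
      using M conjK car unfolding maximal_subgroup_def by metis
    then show "L = K \<or> L = carrier G"
      using inj[of L K] inj[of L "carrier G"] subgroup.subset[OF L(1)] subgroup.subset[OF sK] by blast
  qed
qed

text \<open>Otherwise a pair of maximal subgroups with largest intersection \<open>D\<close> makes \<open>D\<close> normal and contained
  in all maximal subgroups, so that distinct maximal subgroups meet exactly in \<open>D\<close>.  Each class of
  conjugate maximal subgroups then covers at least \<open>|G|/2\<close> elements outside \<open>D\<close>, but never all of them,
  so two classes already cover too much.\<close>

lemma normal_maximal_subgroup_exists:
  assumes fin: "finite (carrier G)" and nc: "\<not> cyclic_group G"
    and nil: "\<And>H. proper_subgroup H G \<Longrightarrow> nilpotent_group (G\<lparr>carrier := H\<rparr>)"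
  shows "\<exists>M. maximal_subgroup M \<and> M \<lhd> G"
proof (rule ccontr)
  assume "\<not> ?thesis"
  then have self_norm: "normalizer G M = M" if "maximal_subgroup M" for M
    using maximal_subgroup_normal_or_self_normalizing that by blast
  have sub: "subgroup M G" "M \<subseteq> carrier G" "M \<noteq> carrier G" if "maximal_subgroup M" for M
    using that subgroup.subset by (auto simp: maximal_subgroup_def)
  have finM: "finite M" if "maximal_subgroup M" for M
    using sub(2)[OF that] fin finite_subset by blast
  have incl: "M = K" if "maximal_subgroup M" "maximal_subgroup K" "M \<subseteq> K" for M K
    using that unfolding maximal_subgroup_def by blast
  have nilM: "nilpotent_group (G\<lparr>carrier := M\<rparr>)" if "maximal_subgroup M" for M
    using nil sub(1,3)[OF that] unfolding proper_subgroup_def by blast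
  obtain M0 where M0: "maximal_subgroup M0"
    using cyclic_if_avoids_maximal_subgroups[OF fin one_closed] nc by blast
  \<comment> \<open>A maximal subgroup that is not normal has a second conjugate, so there are pairs
    of distinct maximal subgroups to choose from.\<close>
  obtain g where g: "g \<in> carrier G" "g \<notin> M0" using sub[OF M0] by blast
  let ?M1 = "(\<lambda>h. g \<otimes> h \<otimes> inv g) ` M0"
  have "?M1 \<noteq> M0" using g self_norm[OF M0] normalizer_iff[OF sub(2)[OF M0], of g] by auto
  moreover have "maximal_subgroup ?M1"
    using maximal_subgroup_conjugates[OF M0] g by (auto simp: conjugates_def)
  ultimately have "\<exists>P. maximal_subgroup (fst P) \<and> maximal_subgroup (snd P) \<and> fst P \<noteq> snd P"
    using M0 by (metis fst_conv snd_conv)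
  moreover have "card (fst P \<inter> snd P) < Suc (order G)"
    if "maximal_subgroup (fst P) \<and> maximal_subgroup (snd P) \<and> fst P \<noteq> snd P" for P
    using that sub(2) fin by (auto simp: order_def less_Suc_eq_le intro!: card_mono)
  ultimately obtain P where "maximal_subgroup (fst P) \<and> maximal_subgroup (snd P) \<and> fst P \<noteq> snd P"
    "\<And>Q. maximal_subgroup (fst Q) \<and> maximal_subgroup (snd Q) \<and> fst Q \<noteq> snd Q
       \<Longrightarrow> card (fst Q \<inter> snd Q) \<le> card (fst P \<inter> snd P)"
    using ex_has_greatest_nat[of "\<lambda>P. maximal_subgroup (fst P) \<and> maximal_subgroup (snd P) \<and> fst P \<noteq> snd P"
        _ "\<lambda>P. card (fst P \<inter> snd P)" "Suc (order G)"] by blast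
  then obtain A B where A: "maximal_subgroup A" and B: "maximal_subgroup B" and AB: "A \<noteq> B"
    and big: "\<And>K L. \<lbrakk>maximal_subgroup K; maximal_subgroup L; K \<noteq> L\<rbrakk> \<Longrightarrow> card (K \<inter> L) \<le> card (A \<inter> B)"
    by (metis fst_conv snd_conv)
  define D where "D = A \<inter> B"
  have sD: "subgroup D G" unfolding D_def using sub A B by (intro subgroups_Inter_pair) auto
  have subD: "D \<subseteq> carrier G" using sD by (rule subgroup.subset)
  have same: "K = L" if "maximal_subgroup K" "maximal_subgroup L" "D \<subset> K \<inter> L" for K L
  proof (rule ccontr)
    assume "K \<noteq> L"
    then have "card (K \<inter> L) \<le> card D" using big[OF that(1,2)] by (simp add: D_def)
    moreover have "card D < card (K \<inter> L)" using that finM by (intro psubset_card_mono) auto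
    ultimately show False by simp
  qed
  have DA: "D \<subset> A" "D \<subset> B" using incl[OF A B] incl[OF B A] AB by (auto simp: D_def)
  \<comment> \<open>If the normalizer of \<open>D\<close> were proper, it would lie in a maximal
    \<open>L\<close>. For a maximal \<open>K\<close> properly above \<open>D\<close>, normalizers
    grow inside \<open>K\<close>, so \<open>K \<inter> L\<close> is larger than \<open>D\<close> and
    \<open>K = L\<close> by the choice of \<open>D\<close>. This would identify \<open>A\<close>
    with \<open>B\<close>.\<close>
  have nD: "D \<lhd> G"
  proof (rule ccontr)
    assume "\<not> D \<lhd> G"
    then have "normalizer G D \<noteq> carrier G" using normal_iff_normalizer[OF sD] by blast
    then obtain L where L: "maximal_subgroup L" "normalizer G D \<subseteq> L"
      using maximal_subgroup_exists[OF fin normalizer_imp_subgroup[OF subD]] by blast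
    have "K = L" if K: "maximal_subgroup K" "D \<subset> K" for K
    proof (rule same[OF K(1) L(1)])
      obtain x where "x \<in> K" "x \<notin> D" "x \<in> normalizer G D"
        using nilpotent_subgroup_normalizer_grows[OF fin sub(1)[OF K(1)] nilM[OF K(1)] sD K(2)] by blast
      then show "D \<subset> K \<inter> L" using K(2) L(2) subgroup_subset_normalizer[OF sD] by blast
    qed
    then show False using A B DA AB by blast
  qed
  interpret D: normal D G by (rule nD)
  \<comment> \<open>Otherwise \<open>D <#> M\<close> is the whole group, whence \<open>A\<close> is
    the product of \<open>D\<close> and \<open>M \<inter> A\<close>. An element \<open>x\<close> of
    \<open>M\<close> outside \<open>A\<close> that normalizes \<open>M \<inter> A\<close> then
    normalizes \<open>A\<close>, since \<open>D\<close> is normal; but \<open>A\<close> is its own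
    normalizer.\<close>
  have DM: "D \<subseteq> M" if M: "maximal_subgroup M" for M
  proof (rule ccontr)
    assume nsub: "\<not> D \<subseteq> M"
    have sDM: "subgroup (D <#> M) G"
      using second_isomorphism_grp.normal_set_mult_subgroup[of D G M] sub(1)[OF M] nD
      by (simp add: second_isomorphism_grp_def second_isomorphism_grp_axioms_def)
    have "M \<subseteq> D <#> M"
    proof
      fix m assume "m \<in> M"
      then have "m = \<one> \<otimes> m" "\<one> \<in> D" using sub(2)[OF M] D.one_closed by auto
      then show "m \<in> D <#> M" using \<open>m \<in> M\<close> unfolding set_mult_def by blast
    qed
    moreover have "D \<subseteq> D <#> M"
    proof
      fix d assume "d \<in> D"
      then have "d = d \<otimes> \<one>" "\<one> \<in> M" using subD subgroup.one_closed[OF sub(1)[OF M]] by auto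
      then show "d \<in> D <#> M" using \<open>d \<in> D\<close> unfolding set_mult_def by blast
    qed
    ultimately have DMc: "D <#> M = carrier G" using M sDM nsub unfolding maximal_subgroup_def by blast
    have "M \<noteq> A" using nsub DA by blast
    then have "M \<inter> A \<subset> M" using incl[OF M A] by blast
    moreover have "subgroup (M \<inter> A) G" using sub M A by (intro subgroups_Inter_pair) auto
    ultimately obtain x where x: "x \<in> M" "x \<notin> M \<inter> A" "x \<in> normalizer G (M \<inter> A)"
      using nilpotent_subgroup_normalizer_grows[OF fin sub(1)[OF M] nilM[OF M]] by blast
    have xG: "x \<in> carrier G" using x sub(2)[OF M] by blast
    have "x \<otimes> a \<otimes> inv x \<in> A" if a: "a \<in> A" for a
    proof -
      have aG: "a \<in> carrier G" using a sub(2)[OF A] by blast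
      then have "a \<in> D <#> M" using DMc by simp
      then obtain d m where dm: "d \<in> D" "m \<in> M" "a = d \<otimes> m" by (auto simp: set_mult_def)
      have dmG: "d \<in> carrier G" "m \<in> carrier G" using dm subD sub(2)[OF M] by auto
      have "inv d \<otimes> a \<in> A"
        using a dm(1) DA(1) subgroup.m_closed[OF sub(1)[OF A]] subgroup.m_inv_closed[OF sub(1)[OF A]] by blast
      moreover have "inv d \<otimes> a = m" using dm dmG by (simp flip: m_assoc)
      ultimately have "m \<in> M \<inter> A" using dm by simp
      then have "x \<otimes> m \<otimes> inv x \<in> A" using normalizerD[OF _ x(3)] sub(2)[OF M] by blast
      moreover have "x \<otimes> d \<otimes> inv x \<in> A" using D.inv_op_closed2[OF xG dm(1)] DA(1) by blast
      ultimately have "(x \<otimes> d \<otimes> inv x) \<otimes> (x \<otimes> m \<otimes> inv x) \<in> A"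
        using subgroup.m_closed[OF sub(1)[OF A]] by blast
      moreover have "inv x \<otimes> (x \<otimes> w) = w" if "w \<in> carrier G" for w
        using that xG by (simp flip: m_assoc)
      ultimately show ?thesis using dm dmG xG by (simp add: m_assoc)
    qed
    then have "x \<in> normalizer G A" using normalizerI[OF sub(2)[OF A] finM[OF A] xG] by blast
    then show False using self_norm[OF A] x by blast
  qed
  have inter: "K \<inter> L = D" if "maximal_subgroup K" "maximal_subgroup L" "K \<noteq> L" for K L
    using same[OF that(1,2)] DM that by blast
  have psub: "D \<subset> M" if M: "maximal_subgroup M" for M
    using DM[OF M] incl[OF M A] incl[OF M B] AB by (auto simp: D_def)
  define U where "U M = (\<Union>K\<in>conjugates M. K - D)" for M
  have subU: "U M \<subseteq> carrier G - D" if "maximal_subgroup M" for M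
    using sub(2) maximal_subgroup_conjugates[OF that] by (auto simp: U_def)
  have posD: "card D > 0" using card_subgroup_pos[OF fin sD] .
  \<comment> \<open>Write c, m, d for the number of conjugates, \<open>card M\<close> and
    \<open>card D\<close>. Self-normalization gives c m = |G|, so |U M| = c (m - d) = |G| - c d. As
    d divides m properly, m <= 2 (m - d), which is the first bound; c >= 2 gives the second.\<close>
  have cardU: "order G \<le> 2 * card (U M)" "card (U M) + card D < order G" if M: "maximal_subgroup M" for M
  proof -
    have cM: "card (conjugates M) * card M = order G"
      using card_conjugates_mult_normalizer[OF sub(2)[OF M]] self_norm[OF M] by simp
    have fc: "finite (conjugates M)" using fin by (simp add: conjugates_def)
    have card_conj: "card (K - D) = card M - card D" if K: "K \<in> conjugates M" for K
    proof -
      have "card K = card M" using K card_conj_set[OF sub(2)[OF M]] by (auto simp: conjugates_def)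
      then show ?thesis
        using card_Diff_subset[OF finite_subset[OF subD fin] DM[OF maximal_subgroup_conjugates[OF M K]]] by simp
    qed
    have "card (U M) = (\<Sum>K\<in>conjugates M. card (K - D))"
      unfolding U_def
    proof (rule card_UN_disjoint[OF fc])
      show "\<forall>K\<in>conjugates M. finite (K - D)" using finM maximal_subgroup_conjugates[OF M] by blast
      show "\<forall>K\<in>conjugates M. \<forall>L\<in>conjugates M. K \<noteq> L \<longrightarrow> (K - D) \<inter> (L - D) = {}"
        using inter maximal_subgroup_conjugates[OF M] by blast
    qed
    then have cU: "card (U M) = card (conjugates M) * (card M - card D)" using card_conj by simp
    have lt: "card D < card M" using psub[OF M] finM[OF M] by (intro psubset_card_mono)
    obtain k where k: "card M = card D * k"
      using card_subgroup_dvd[OF sD sub(1)[OF M] DM[OF M]] by blast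
    have "k \<noteq> 0" "k \<noteq> 1" using k lt by auto
    then have "2 \<le> k" by simp
    then have two: "2 * card D \<le> card M" using k by simp
    have "card M < order G"
      unfolding order_def using sub(2,3)[OF M] fin by (intro psubset_card_mono) auto
    then have "card (conjugates M) \<noteq> 0" "card (conjugates M) \<noteq> 1"
      using cM by (metis mult_0 not_less_zero) (metis \<open>card M < order G\<close> cM less_irrefl mult_1)
    then have c2: "2 \<le> card (conjugates M)" by simp
    have "card M \<le> 2 * (card M - card D)" using two by simp
    then have "card (conjugates M) * card M \<le> card (conjugates M) * (2 * (card M - card D))"
      by (rule mult_le_mono2)
    then show "order G \<le> 2 * card (U M)" using cU cM by simp
    have "card (U M) + card (conjugates M) * card D = order G"
      using cU cM lt by (simp flip: add_mult_distrib2)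
    moreover have "2 * card D \<le> card (conjugates M) * card D" using c2 by simp
    ultimately show "card (U M) + card D < order G" using posD by linarith
  qed
  have finU: "finite (U M)" if "maximal_subgroup M" for M
    using subU[OF that] fin finite_subset by (metis Diff_subset subset_trans)
  \<comment> \<open>An element missed by \<open>U A\<close> and \<open>D\<close> still lies in a
    maximal subgroup, as the group is not cyclic; this one belongs to another class.\<close>
  have "card (U A \<union> D) < order G"
    using cardU(2)[OF A] card_Un_le[of "U A" D] by linarith
  then have "U A \<union> D \<noteq> carrier G" by (auto simp: order_def)
  then obtain x where x: "x \<in> carrier G" "x \<notin> U A" "x \<notin> D" using subU[OF A] subD by blast
  then obtain M where M: "maximal_subgroup M" "x \<in> M"
    using cyclic_if_avoids_maximal_subgroups[OF fin x(1)] nc by blast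
  have "M \<notin> conjugates A" using x M by (auto simp: U_def)
  then have disj: "conjugates A \<inter> conjugates M = {}"
    using conjugates_trans[OF sub(2)[OF A] sub(2)[OF M(1)]] by blast
  have UU: "U A \<inter> U M = {}"
  proof -
    have False if "y \<in> K - D" "K \<in> conjugates A" "y \<in> L - D" "L \<in> conjugates M" for y K L
    proof -
      have "K \<noteq> L" using that disj by blast
      then have "K \<inter> L = D"
        using inter maximal_subgroup_conjugates[OF A] maximal_subgroup_conjugates[OF M(1)] that by blast
      then show False using that by blast
    qed
    then show ?thesis by (auto simp: U_def)
  qed
  have "card (U A \<union> U M) = card (U A) + card (U M)"
    using UU finU A M by (intro card_Un_disjoint) auto
  moreover have "card (U A \<union> U M) \<le> card (carrier G - D)"
    using subU[OF A] subU[OF M(1)] fin by (intro card_mono) auto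
  moreover have "card (carrier G - D) = order G - card D"
    using card_Diff_subset[OF finite_subset[OF subD fin] subD] by (simp add: order_def)
  moreover have "card D \<le> order G" unfolding order_def using subD fin by (rule card_mono[rotated])
  ultimately show False using cardU(1)[OF A] cardU(1)[OF M(1)] posD by linarith
qed

subsection \<open>Schmidt groups\<close>

lemma p_subgroup_subset_normal_sylow:
  assumes fin: "finite (carrier G)" and p: "Factorial_Ring.prime p"
    and P: "subgroup P G" "card P = p ^ k" and S: "sylow_subgroup p S" "S \<lhd> G"
  shows "P \<subseteq> S"
proof
  fix x assume x: "x \<in> P"
  have sS: "subgroup S G" using S(2) by (rule normal_imp_subgroup)
  obtain g where g: "g \<in> carrier G" "\<forall>x\<in>P. g \<otimes> x \<otimes> inv g \<in> S"
    using p_subgroup_subconjugate[OF fin p P sS sylow_subgroup_index[OF fin p S(1)]] by blast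
  have xG: "x \<in> carrier G" using x subgroup.mem_carrier[OF P(1)] by blast
  have "inv g \<otimes> (g \<otimes> x \<otimes> inv g) \<otimes> g \<in> S"
    using normal.inv_op_closed1[OF S(2) g(1)] g(2) x by blast
  moreover have "inv g \<otimes> (g \<otimes> w) = w" if "w \<in> carrier G" for w
    using that g by (simp flip: m_assoc)
  ultimately show "x \<in> S" using g(1) xG by (simp add: m_assoc)
qed

lemma nilpotent_coprime_subgroups_commute:
  assumes nil: "nilpotent_group G" and fin: "finite (carrier G)"
    and p: "Factorial_Ring.prime p" and q: "Factorial_Ring.prime q" and pq: "p \<noteq> q"
    and P: "subgroup P G" "card P = p ^ k" and Q: "subgroup Q G" "card Q = q ^ l"
    and x: "x \<in> P" and y: "y \<in> Q"
  shows "x \<otimes> y = y \<otimes> x"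
proof -
  obtain S T where S: "sylow_subgroup p S" and T: "sylow_subgroup q T"
    using sylow_subgroup_exists[OF fin] p q by blast
  have n: "S \<lhd> G" "T \<lhd> G"
    using nilpotent_sylow_normal[OF nil fin] p q S T by blast+
  have "x \<in> S" "y \<in> T"
    using p_subgroup_subset_normal_sylow[OF fin p P S n(1)] p_subgroup_subset_normal_sylow[OF fin q Q T n(2)] x y
    by blast+
  then show ?thesis by (rule normal_sylow_subgroups_commute[OF fin p q pq S T n])
qed

text \<open>All commutators vanish, so the series is trivial at index 1. In particular, a Schmidt
  group is not cyclic, and the minimality condition on noncyclic subgroups can be applied to
  it.\<close>

lemma cyclic_imp_nilpotent:
  assumes "cyclic_group G"
  shows "nilpotent_group G"
proof -
  interpret comm_group G using cyclic_imp_abelian_group[OF assms] .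
  have "h \<otimes> g \<otimes> inv h \<otimes> inv g = \<one>" if "h \<in> carrier G" "g \<in> carrier G" for h g
  proof -
    have "h \<otimes> g \<otimes> inv h \<otimes> inv g = (h \<otimes> inv h) \<otimes> (g \<otimes> inv g)"
      using that by (simp add: m_ac del: r_inv)
    then show ?thesis using that by simp
  qed
  then have "(\<Union>h\<in>carrier G. \<Union>g\<in>carrier G. {h \<otimes> g \<otimes> inv h \<otimes> inv g}) = {\<one>}"
    by auto
  then have "lower_central G (Suc 0) = {\<one>}" by (simp add: generate_one)
  then show ?thesis unfolding nilpotent_group_def using is_group by blast
qed

lemma card_set_mult_le:
  assumes "finite A" "finite B"
  shows "card (A <#> B) \<le> card A * card B"
proof -
  have "A <#> B = (\<lambda>(a, b). a \<otimes> b) ` (A \<times> B)" by (auto simp: set_mult_def)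
  then show ?thesis
    using assms card_image_le[of "A \<times> B" "\<lambda>(a, b). a \<otimes> b"] by (simp add: card_cartesian_product)
qed

text \<open>Let \<open>Q\<close> be the Sylow subgroup that is not normal and \<open>R\<close> a
  normal Sylow subgroup, for another prime, that does not normalize \<open>Q\<close>. If
  \<open>R <#> generate G {y}\<close> were proper for every \<open>y\<close> in \<open>Q\<close>, it
  would be nilpotent and \<open>y\<close> would commute with \<open>R\<close>; then \<open>R\<close>
  would normalize \<open>Q\<close>. So one \<open>y\<close> gives the whole group, and by order it
  generates \<open>Q\<close>.\<close>

lemma minimal_nonnilpotent_cyclic_sylow:
  assumes fin: "finite (carrier G)" and nn: "\<not> nilpotent_group G"
    and nil: "\<And>H. proper_subgroup H G \<Longrightarrow> nilpotent_group (G\<lparr>carrier := H\<rparr>)"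
  shows "\<exists>q y. Factorial_Ring.prime q \<and> y \<in> carrier G \<and>
    sylow_subgroup q (generate G {y}) \<and> \<not> generate G {y} \<lhd> G"
proof -
  have "\<not> cyclic_group G" using nn cyclic_imp_nilpotent by blast
  then obtain M where M: "maximal_subgroup M" "M \<lhd> G"
    using normal_maximal_subgroup_exists[OF fin _ nil] by blast
  have sM: "subgroup M G" using M(2) by (rule normal_imp_subgroup)
  have subM: "M \<subseteq> carrier G" using sM by (rule subgroup.subset)
  interpret M: group "G\<lparr>carrier := M\<rparr>" using sM by (rule subgroup_imp_group)
  have finM: "finite (carrier (G\<lparr>carrier := M\<rparr>))" using fin finite_subset[OF subM] by simp
  have nilM: "nilpotent_group (G\<lparr>carrier := M\<rparr>)"
    using nil M(1) sM by (simp add: maximal_subgroup_def proper_subgroup_def)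
  define q where "q = card (rcosets M)"
  have q: "Factorial_Ring.prime q" unfolding q_def by (rule normal_maximal_subgroup_index_prime[OF fin M(2,1)])
  have ord: "order G = q * card M" using lagrange[OF sM] by (simp add: q_def)
  have posM: "card M > 0" using card_subgroup_pos[OF fin sM] .
  have normal: "R \<lhd> G" if r: "Factorial_Ring.prime r" "r \<noteq> q" and R: "sylow_subgroup r R" for r R
  proof -
    \<comment> \<open>The index \<open>q\<close> of \<open>M\<close> is prime to \<open>r\<close>,
      so Sylow \<open>r\<close>-subgroups of \<open>M\<close> are Sylow subgroups of the whole
      group.\<close>
    have m: "multiplicity r (card M) = multiplicity r (order G)"
      using r q posM ord by (simp add: prime_elem_multiplicity_mult_distrib multiplicity_distinct_prime_power prime_multiplicity_other)
    obtain T where T: "M.sylow_subgroup r T" using M.sylow_subgroup_exists[OF finM r(1)] by blast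
    have nT: "T \<lhd> G\<lparr>carrier := M\<rparr>" using M.nilpotent_sylow_normal[OF nilM finM r(1) T] .
    have sT: "sylow_subgroup r T" using sylow_subgroup_of_subgroup[OF fin sM T m] .
    then have T': "subgroup T G" "T \<subseteq> M"
      using M.sylow_subgroup_subset[OF T] by (auto simp: sylow_subgroup_def)
    have subT: "T \<subseteq> carrier G" using T' subM by blast
    have "carrier G \<subseteq> normalizer G T"
    proof
      fix g assume g: "g \<in> carrier G"
      let ?T = "(\<lambda>h. g \<otimes> h \<otimes> inv g) ` T"
      have "sylow_subgroup r ?T"
        using sT subgroup_conj[OF T'(1) g] card_conj_set[OF subT g] by (simp add: sylow_subgroup_def)
      moreover have "?T \<subseteq> M" using normal.inv_op_closed2[OF M(2) g] T'(2) by blast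
      ultimately have "M.sylow_subgroup r ?T" using sylow_subgroup_restrict[OF fin r(1) _ sM] by blast
      then have "T = ?T" using M.normal_sylow_subgroup_unique[OF finM r(1) T _ nT] by blast
      then show "g \<in> normalizer G T" using normalizer_iff[OF subT] g by simp
    qed
    then have "T \<lhd> G" using normal_iff_normalizer[OF T'(1)] normalizer_subset_carrier[OF subT] by blast
    then show ?thesis using normal_sylow_subgroup_unique[OF fin r(1) sT R] by simp
  qed
  obtain Q where Q: "sylow_subgroup q Q" "\<not> Q \<lhd> G"
    using nilpotent_if_sylow_normal[OF fin] nn normal by blast
  have sQ: "subgroup Q G" and cQ: "card Q = q ^ multiplicity q (order G)"
    using Q(1) by (auto simp: sylow_subgroup_def)
  have subQ: "Q \<subseteq> carrier G" using sQ by (rule subgroup.subset)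
  have "normalizer G Q \<noteq> carrier G" using normal_iff_normalizer[OF sQ] Q(2) by blast
  \<comment> \<open>A proper subgroup cannot contain Sylow subgroups for all primes; the prime it
    misses is not \<open>q\<close>, because the normalizer contains \<open>Q\<close>.\<close>
  then obtain r where r: "Factorial_Ring.prime r" "\<And>R. sylow_subgroup r R \<Longrightarrow> \<not> R \<subseteq> normalizer G Q"
    using eq_carrier_if_contains_sylow[OF fin normalizer_imp_subgroup[OF subQ]] by blast
  have rq: "r \<noteq> q" using r(2) Q(1) subgroup_subset_normalizer[OF sQ] by blast
  obtain R where R: "sylow_subgroup r R" using sylow_subgroup_exists[OF fin r(1)] by blast
  have nR: "R \<lhd> G" using normal[OF r(1) rq R] .
  have sR: "subgroup R G" and cR: "card R = r ^ multiplicity r (order G)"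
    using R by (auto simp: sylow_subgroup_def)
  have subR: "R \<subseteq> carrier G" using sR by (rule subgroup.subset)
  have "\<exists>y\<in>Q. R <#> generate G {y} = carrier G"
  proof (rule ccontr)
    assume contra: "\<not> ?thesis"
    have comm: "x \<otimes> y = y \<otimes> x" if x: "x \<in> R" and y: "y \<in> Q" for x y
    proof -
      let ?Y = "generate G {y}"
      let ?K = "R <#> ?Y"
      have yG: "y \<in> carrier G" using y subQ by blast
      have sY: "subgroup ?Y G" using yG generate_is_subgroup by simp
      have sK: "subgroup ?K G"
        using second_isomorphism_grp.normal_set_mult_subgroup[of R G ?Y] sY nR
        by (simp add: second_isomorphism_grp_def second_isomorphism_grp_axioms_def)
      have RK: "R \<subseteq> ?K"
      proof
        fix m assume m: "m \<in> R"
        then have "m = m \<otimes> \<one>" "\<one> \<in> ?Y" using subR subgroup.one_closed[OF sY] by auto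
        then show "m \<in> ?K" using m unfolding set_mult_def by blast
      qed
      have YK: "?Y \<subseteq> ?K"
      proof
        fix m assume m: "m \<in> ?Y"
        then have "m = \<one> \<otimes> m" "\<one> \<in> R" using subgroup.mem_carrier[OF sY] subgroup.one_closed[OF sR] by auto
        then show "m \<in> ?K" using m unfolding set_mult_def by blast
      qed
      interpret K: group "G\<lparr>carrier := ?K\<rparr>" using sK by (rule subgroup_imp_group)
      have finK: "finite (carrier (G\<lparr>carrier := ?K\<rparr>))"
        using fin finite_subset[OF subgroup.subset[OF sK]] by simp
      have nilK: "nilpotent_group (G\<lparr>carrier := ?K\<rparr>)"
        using nil sK contra y by (simp add: proper_subgroup_def)
      have "?Y \<subseteq> Q" using generate_subgroup_incl[OF _ sQ] y by simp
      then have "card ?Y dvd q ^ multiplicity q (order G)"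
        using card_subgroup_dvd[OF sY sQ] cQ by simp
      then obtain l where l: "card ?Y = q ^ l" using q divides_primepow_nat by blast
      have "y \<in> ?Y" by (simp add: generate.incl)
      then have "x \<otimes>\<^bsub>G\<lparr>carrier := ?K\<rparr>\<^esub> y = y \<otimes>\<^bsub>G\<lparr>carrier := ?K\<rparr>\<^esub> x"
        using K.nilpotent_coprime_subgroups_commute[OF nilK finK r(1) q rq subgroup_incl[OF sR sK RK] cR
            subgroup_incl[OF sY sK YK] l x] by blast
      then show ?thesis by simp
    qed
    have "R \<subseteq> normalizer G Q"
    proof
      fix x assume x: "x \<in> R"
      have xG: "x \<in> carrier G" using x subR by blast
      have "x \<otimes> y \<otimes> inv x \<in> Q" if y: "y \<in> Q" for y
      proof -
        have "x \<otimes> y \<otimes> inv x = y \<otimes> (x \<otimes> inv x)"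
          using comm[OF x y] xG y subQ by (simp add: m_assoc subset_iff del: r_inv)
        then show ?thesis using xG y subQ by auto
      qed
      then show "x \<in> normalizer G Q"
        using normalizerI[OF subQ _ xG] finite_subset[OF subQ fin] by blast
    qed
    then show False using r(2)[OF R] by blast
  qed
  then obtain y where y: "y \<in> Q" "R <#> generate G {y} = carrier G" by blast
  have yG: "y \<in> carrier G" using y(1) subQ by blast
  have YQ: "generate G {y} \<subseteq> Q" using generate_subgroup_incl[OF _ sQ] y(1) by simp
  have finR: "finite R" and finQ: "finite Q" using fin finite_subset subR subQ by blast+
  have posR: "card R > 0" using card_subgroup_pos[OF fin sR] .
  have posG: "order G > 0" using fin order_gt_0_iff_finite by blast
  \<comment> \<open>The orders of \<open>R\<close> and \<open>Q\<close> are coprime, so their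
    product is at most the order of \<open>R <#> generate G {y}\<close>, which forces
    \<open>generate G {y}\<close> to be as large as \<open>Q\<close>.\<close>
  have "card R * card Q dvd order G"
    using card_distinct_sylow_coprime[OF r(1) q rq R Q(1)] card_subgroup_dvd_order sR sQ
    by (simp add: divides_mult)
  then have "card R * card Q \<le> order G" using posG by (rule dvd_imp_le)
  also have "\<dots> \<le> card R * card (generate G {y})"
    using card_set_mult_le[OF finR finite_subset[OF YQ finQ]] y(2) by (simp add: order_def)
  finally have "card Q \<le> card (generate G {y})" using posR by simp
  then have "generate G {y} = Q" using card_seteq[OF finQ YQ] by simp
  then show ?thesis using q yG Q by auto
qed

section \<open>Counting components against conjugate Sylow subgroups\<close>

lemma no_ES_partition_into_nilpotent_subgroups:
  assumes fin: "finite (carrier G)" and q: "Factorial_Ring.prime q" and y: "y \<in> carrier G"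
    and Y: "sylow_subgroup q (generate G {y})" "\<not> generate G {y} \<lhd> G"
    and nil: "\<And>H. H \<in> \<H> \<Longrightarrow> nilpotent_group (G\<lparr>carrier := H\<rparr>)"
  shows "\<not> ES_partition G S \<H>"
proof
  assume ES: "ES_partition G S \<H>"
  let ?Y = "generate G {y}"
  have S: "subgroup S G" and finH: "finite \<H>" and sub: "\<And>H. H \<in> \<H> \<Longrightarrow> subgroup H G"
    and proper: "\<And>H. H \<in> \<H> \<Longrightarrow> H \<noteq> carrier G" and cover: "carrier G = \<Union>\<H>"
    and inter: "\<And>H K. \<lbrakk>H \<in> \<H>; K \<in> \<H>; H \<noteq> K\<rbrakk> \<Longrightarrow> H \<inter> K = S"
    and card_eq: "\<And>H K. \<lbrakk>H \<in> \<H>; K \<in> \<H>\<rbrakk> \<Longrightarrow> card H = card K"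
    using ES unfolding ES_partition_def strict_partition_def proper_subgroup_def by blast+
  have sY: "subgroup ?Y G" and cY: "card ?Y = q ^ multiplicity q (order G)"
    using Y by (auto simp: sylow_subgroup_def)
  have posG: "order G > 0" using fin order_gt_0_iff_finite by blast
  obtain H0 where H0: "H0 \<in> \<H>" "y \<in> H0" using y cover by blast
  define h where "h = card H0"
  have h: "card H = h" if "H \<in> \<H>" for H using card_eq[OF that H0(1)] by (simp add: h_def)
  have posh: "h > 0" unfolding h_def using card_subgroup_pos[OF fin sub[OF H0(1)]] .
  have YH0: "?Y \<subseteq> H0" using generate_subgroup_incl[OF _ sub[OF H0(1)]] H0(2) by simp
  have "q ^ multiplicity q (order G) dvd h"
    using card_subgroup_dvd[OF sY sub[OF H0(1)] YH0] cY by (simp add: h_def)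
  then have "multiplicity q (order G) \<le> multiplicity q h"
    using posh q by (metis multiplicity_geI not_prime_unit neq0_conv)
  moreover have "multiplicity q h \<le> multiplicity q (order G)"
    using card_subgroup_dvd_order[OF sub[OF H0(1)]] posG by (simp add: dvd_imp_multiplicity_le h_def)
  ultimately have m: "multiplicity q h = multiplicity q (order G)" by simp
  have ex: "\<exists>P. sylow_subgroup q P \<and> P \<subseteq> H \<and> H \<subseteq> normalizer G P \<and>
      (\<forall>T. sylow_subgroup q T \<longrightarrow> T \<subseteq> H \<longrightarrow> T = P)" if H: "H \<in> \<H>" for H
  proof -
    interpret H: group "G\<lparr>carrier := H\<rparr>" using sub[OF H] by (rule subgroup_imp_group)
    have fH: "finite (carrier (G\<lparr>carrier := H\<rparr>))" using fin finite_subset[OF subgroup.subset[OF sub[OF H]]] by simp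
    obtain P where P: "H.sylow_subgroup q P" using H.sylow_subgroup_exists[OF fH q] by blast
    have nP: "P \<lhd> G\<lparr>carrier := H\<rparr>" using H.nilpotent_sylow_normal[OF nil[OF H] fH q P] .
    have sP: "sylow_subgroup q P" using sylow_subgroup_of_subgroup[OF fin sub[OF H] P] m h[OF H] by simp
    have PH: "P \<subseteq> H" using H.sylow_subgroup_subset[OF P] by simp
    have "H \<subseteq> normalizer G P"
    proof
      fix x assume x: "x \<in> H"
      have "x \<otimes> z \<otimes> inv x \<in> P" if "z \<in> P" for z
        using normal.inv_op_closed2[OF nP _ that, of x] x m_inv_consistent[OF sub[OF H] x] by simp
      then show "x \<in> normalizer G P"
        using normalizerI[OF sylow_subgroup_subset[OF sP] sylow_subgroup_finite[OF fin sP]]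
          subgroup.mem_carrier[OF sub[OF H] x] by blast
    qed
    moreover have "T = P" if "sylow_subgroup q T" "T \<subseteq> H" for T
      using H.normal_sylow_subgroup_unique[OF fH q P _ nP] sylow_subgroup_restrict[OF fin q that(1) sub[OF H] that(2)]
      by simp
    ultimately show ?thesis using sP PH by blast
  qed
  define sylow_of where "sylow_of H P \<longleftrightarrow> sylow_subgroup q P \<and> P \<subseteq> H \<and> H \<subseteq> normalizer G P \<and>
      (\<forall>T. sylow_subgroup q T \<longrightarrow> T \<subseteq> H \<longrightarrow> T = P)" for H P
  have "\<forall>H\<in>\<H>. \<exists>P. sylow_of H P" using ex unfolding sylow_of_def by simp
  then obtain f where "\<forall>H\<in>\<H>. sylow_of H (f H)" by (rule bchoice[THEN exE])
  then have f: "\<And>H. H \<in> \<H> \<Longrightarrow> sylow_subgroup q (f H)" "\<And>H. H \<in> \<H> \<Longrightarrow> f H \<subseteq> H"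
    "\<And>H. H \<in> \<H> \<Longrightarrow> H \<subseteq> normalizer G (f H)"
    "\<And>H T. \<lbrakk>H \<in> \<H>; sylow_subgroup q T; T \<subseteq> H\<rbrakk> \<Longrightarrow> T = f H"
    unfolding sylow_of_def by simp_all
  have "\<H> \<noteq> {H0}"
  proof
    assume "\<H> = {H0}"
    then have "carrier G = H0" using cover by simp
    then show False using proper[OF H0(1)] by simp
  qed
  then obtain K0 where K0: "K0 \<in> \<H>" "K0 \<noteq> H0"
    using H0(1) by blast
  \<comment> \<open>A single component would satisfy the intersection condition vacuously, so for
    \<open>H0\<close> itself the inclusion comes from the second component
    \<open>K0\<close>.\<close>
  have SH: "S \<subseteq> H" if H: "H \<in> \<H>" for H
    using inter[OF H0(1) H] inter[OF H0(1) K0(1)] K0(2) by (cases "H = H0") auto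
  \<comment> \<open>A Sylow subgroup shared by two components lies in \<open>S\<close>, hence in
    every component, and is the Sylow subgroup of each. All components normalize it, so it is
    normal, and then so is the given one.\<close>
  have "inj_on f \<H>"
  proof (rule inj_onI, rule ccontr)
    fix H K assume HK: "H \<in> \<H>" "K \<in> \<H>" "f H = f K" "H \<noteq> K"
    then have fS: "f H \<subseteq> S" using f(2)[OF HK(1)] f(2)[OF HK(2)] inter[OF HK(1,2,4)] by auto
    have "L \<subseteq> normalizer G (f H)" if L: "L \<in> \<H>" for L
      using f(3)[OF L] f(4)[OF L f(1)[OF HK(1)]] fS SH[OF L] by auto
    then have "carrier G \<subseteq> normalizer G (f H)" using cover by blast
    moreover have sf: "subgroup (f H) G" using f(1)[OF HK(1)] by (simp add: sylow_subgroup_def)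
    ultimately have "f H \<lhd> G"
      using normal_iff_normalizer[OF sf] normalizer_subset_carrier[OF subgroup.subset[OF sf]] by blast
    then show False using normal_sylow_subgroup_unique[OF fin q f(1)[OF HK(1)] Y(1)] Y(2) by simp
  qed
  moreover have "f H \<in> conjugates ?Y" if "H \<in> \<H>" for H
    using sylow_subgroup_conjugate[OF fin q Y(1) f(1)[OF that]] unfolding conjugates_def by blast
  then have "f ` \<H> \<subseteq> conjugates ?Y" by blast
  moreover have "finite (conjugates ?Y)" using fin by (simp add: conjugates_def)
  ultimately have n: "card \<H> \<le> card (conjugates ?Y)" by (rule card_inj_on_le)
  have subY: "?Y \<subseteq> carrier G" using sY by (rule subgroup.subset)
  have "H0 \<subseteq> normalizer G ?Y" using f(3)[OF H0(1)] f(4)[OF H0(1) Y(1) YH0] by simp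
  then have "h \<le> card (normalizer G ?Y)"
    unfolding h_def using finite_subset[OF normalizer_subset_carrier[OF subY] fin] by (rule card_mono[rotated])
  then have "card \<H> * h \<le> card (conjugates ?Y) * card (normalizer G ?Y)" using n by (rule mult_le_mono[rotated])
  then have upper: "card \<H> * h \<le> order G" using card_conjugates_mult_normalizer[OF subY] by simp
  have "{H0, K0} \<subseteq> \<H>" using H0 K0 by simp
  then have "card {H0, K0} \<le> card \<H>" using finH by (rule card_mono[rotated])
  then have two: "2 \<le> card \<H>" using K0(2) by simp
  have finS: "finite S" using fin finite_subset[OF subgroup.subset[OF S]] by blast
  have posS: "card S > 0" using card_subgroup_pos[OF fin S] .
  have Sh: "card S \<le> h"
    unfolding h_def using SH[OF H0(1)] fin finite_subset[OF subgroup.subset[OF sub[OF H0(1)]]] by (intro card_mono) auto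
  \<comment> \<open>The union bound |G| <= |S| + n (h - |S|) suffices: with n h <= |G| it gives n
    |S| <= |S|, against n >= 2 and |S| > 0.\<close>
  have "carrier G \<subseteq> S \<union> (\<Union>H\<in>\<H>. H - S)" using cover by blast
  moreover have "finite (S \<union> (\<Union>H\<in>\<H>. H - S))"
    using finite_subset[OF _ fin, of "S \<union> (\<Union>H\<in>\<H>. H - S)"] cover subgroup.subset[OF S] by auto
  ultimately have "order G \<le> card (S \<union> (\<Union>H\<in>\<H>. H - S))"
    unfolding order_def by (rule card_mono[rotated])
  also have "\<dots> \<le> card S + card (\<Union>H\<in>\<H>. H - S)" by (rule card_Un_le)
  also have "card (\<Union>H\<in>\<H>. H - S) \<le> (\<Sum>H\<in>\<H>. card (H - S))" using finH by (rule card_UN_le)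
  also have "(\<Sum>H\<in>\<H>. card (H - S)) = (\<Sum>H\<in>\<H>. h - card S)"
    using card_Diff_subset[OF finS SH] h by (intro sum.cong) auto
  finally have "order G \<le> card S + card \<H> * (h - card S)" by simp
  moreover have "card \<H> * (h - card S) + card \<H> * card S = card \<H> * h"
    using Sh by (simp flip: add_mult_distrib2)
  moreover have "2 * card S \<le> card \<H> * card S" using two by simp
  ultimately show False using upper posS by linarith
qed

end

section \<open>The two classes of groups coincide\<close>

theorem Schmidt_group_no_ES_partition:
  assumes "Schmidt_group G"
  shows "\<not> ES_partition G S \<H>"
proof -
  interpret group G using assms by (simp add: Schmidt_group_def)
  have fin: "finite (carrier G)" and nn: "\<not> nilpotent_group G"
    and nil: "\<And>H. proper_subgroup H G \<Longrightarrow> nilpotent_group (G\<lparr>carrier := H\<rparr>)"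
    using assms by (auto simp: Schmidt_group_def)
  show ?thesis
  proof
    assume ES: "ES_partition G S \<H>"
    then have "nilpotent_group (G\<lparr>carrier := H\<rparr>)" if "H \<in> \<H>" for H
      using nil that by (auto simp: ES_partition_def strict_partition_def)
    then show False
      using minimal_nonnilpotent_cyclic_sylow[OF fin nn nil] no_ES_partition_into_nilpotent_subgroups[OF fin] ES
      by blast
  qed
qed

text \<open>A nonnilpotent subgroup of least order will do, as its proper subgroups are smaller
  subgroups of the whole group.\<close>

lemma (in group) nonnilpotent_contains_Schmidt_group:
  assumes fin: "finite (carrier G)" and nn: "\<not> nilpotent_group G"
  shows "\<exists>H. subgroup H G \<and> Schmidt_group (G\<lparr>carrier := H\<rparr>)"
proof -
  let ?P = "\<lambda>H. subgroup H G \<and> \<not> nilpotent_group (G\<lparr>carrier := H\<rparr>)"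
  have "?P (carrier G)" using nn subgroup_self by simp
  then obtain H where H: "?P H" "\<And>K. ?P K \<Longrightarrow> card H \<le> card K"
    using ex_has_least_nat[of ?P _ card] by blast
  interpret H: group "G\<lparr>carrier := H\<rparr>" using H(1) subgroup_imp_group by blast
  have finH: "finite H" using fin finite_subset[OF subgroup.subset] H(1) by blast
  have "nilpotent_group (G\<lparr>carrier := K\<rparr>)" if "proper_subgroup K (G\<lparr>carrier := H\<rparr>)" for K
  proof (rule ccontr)
    assume "\<not> ?thesis"
    moreover have K: "subgroup K G" "K \<subset> H"
      using that H(1) subgroup_restrict_iff[of H K] by (auto simp: proper_subgroup_def)
    ultimately have "card H \<le> card K" using H(2) by blast
    then show False using psubset_card_mono[OF finH K(2)] by simp
  qed
  then have "Schmidt_group (G\<lparr>carrier := H\<rparr>)"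
    using H(1) finH H.is_group by (simp add: Schmidt_group_def)
  then show ?thesis using H(1) by blast
qed

theorem corollary2p9:
  fixes G :: "('a, 'b) monoid_scheme"
  assumes "group G" and "finite (carrier G)" and "\<not> cyclic_group G"
  shows "minimal_non_ES_partition_group G \<longleftrightarrow> Schmidt_group G"
proof
  interpret group G by fact
  {
    assume min: "minimal_non_ES_partition_group G"
    then have "\<not> nilpotent_group G"
      using nilpotent_noncyclic_ES_partition assms(2,3) by (auto simp: minimal_non_ES_partition_group_def)
    then obtain H where H: "subgroup H G" "Schmidt_group (G\<lparr>carrier := H\<rparr>)"
      using nonnilpotent_contains_Schmidt_group[OF assms(2)] by blast
    interpret H: group "G\<lparr>carrier := H\<rparr>" using H(1) by (rule subgroup_imp_group)
    have "\<not> cyclic_group (G\<lparr>carrier := H\<rparr>)"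
      using H.cyclic_imp_nilpotent H(2) by (auto simp: Schmidt_group_def)
    moreover have "\<not> ES_partition (G\<lparr>carrier := H\<rparr>) T \<H>" for T \<H>
      using Schmidt_group_no_ES_partition[OF H(2)] .
    \<comment> \<open>Were \<open>H\<close> proper, minimality would provide the noncyclic
      \<open>H\<close> with a partition.\<close>
    ultimately have "H = carrier G"
      using min H(1) unfolding minimal_non_ES_partition_group_def proper_subgroup_def by blast
    then show "Schmidt_group G" using H(2) by simp
  next
    assume S: "Schmidt_group G"
    have "\<exists>T \<H>. subgroup T (G\<lparr>carrier := H\<rparr>) \<and> ES_partition (G\<lparr>carrier := H\<rparr>) T \<H>"
      if H: "proper_subgroup H G" "\<not> cyclic_group (G\<lparr>carrier := H\<rparr>)" for H
    proof -
      have sH: "subgroup H G" using H(1) by (simp add: proper_subgroup_def)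
      interpret H: group "G\<lparr>carrier := H\<rparr>" using sH by (rule subgroup_imp_group)
      have "finite (carrier (G\<lparr>carrier := H\<rparr>))"
        using assms(2) finite_subset[OF subgroup.subset[OF sH]] by simp
      moreover have "nilpotent_group (G\<lparr>carrier := H\<rparr>)" using S H(1) by (simp add: Schmidt_group_def)
      ultimately show ?thesis using H.nilpotent_noncyclic_ES_partition H(2) by blast
    qed
    then show "minimal_non_ES_partition_group G"
      using assms Schmidt_group_no_ES_partition[OF S] unfolding minimal_non_ES_partition_group_def by blast
  }
qed

end
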